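(* Let $F$ be the isoperimetric quotient of three-dimensional lattices as a function of the six Selling parameters. For every $p,q\ge 0$ with $\det A(p,q,q,q,q,p)>0$ (equivalently, $p\ge 0$ and $q>0$), $$F(p,q,q,q,q,p)\ \ge\ F(1,1,1,1,1,1),$$ with equality if and only if $p=q$.
   Context: For $\boldsymbol{\rho}=(\rho_{01},\rho_{02},\rho_{03},\rho_{12},\rho_{13},\rho_{23})=(a,b,c,d,e,f)\in\mathbb{R}_{\ge 0}^6$ (Selling parameters) put $$A(\boldsymbol{\rho})=\begin{pmatrix} a+d+e & -d & -e\\ -d & b+d+f & -f\\ -e & -f & c+e+f\end{pmatrix}.$$ When $\det A(\boldsymbol{\rho})>0$, $A(\boldsymbol{\rho})$ is the Gram matrix of a basis $(b_1,b_2,b_3)$ of a lattice $\Lambda\subset\mathbb{R}^3$ with $\rho_{ij}=-\langle b_i,b_j\rangle$ for $0\le i<j\le 3$, where $b_0=-b_1-b_2-b_3$. The function $F$ is defined for $\boldsymbol{\rho}\in\mathbb{R}_{\ge0}^6$ with $\det A(\boldsymbol{\rho})>0$ by $F(\boldsymbol{\rho})=A_T(\boldsymbol{\rho})/(\det A(\boldsymbol{\rho}))^{1/3}$, where $A_T(\boldsymbol{\rho})$ is the surface area of the Voronoi cell of $\Lambda$ (whose volume is $\sqrt{\det A(\boldsymbol{\rho})}$). Explicitly, $$ \begin{aligned} F(a,b,c,d,e,f)=\frac{2}{(\det A)^{5/6}}\Big(& a f \sqrt{b+c+d+e} + b e \sqrt{a+c+d+f} + c d \sqrt{a+b+e+f}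 \\ &+ \sqrt{a+b+c}\,(de+df+ef) + \sqrt{a+d+e}\,(bc+bf+cf) \\ &+ \sqrt{b+d+f}\,(ac+ae+ce) + \sqrt{c+e+f}\,(ab+ad+bd)\Big). \end{aligned} $$ *)

theory Defs
  imports "HOL-Analysis.Analysis"
begin

definition selling_matrix :: "real \<Rightarrow> real \<Rightarrow> real \<Rightarrow> real \<Rightarrow> real \<Rightarrow> real \<Rightarrow> real^3^3" where
  "selling_matrix a b c d e f =
     vector [vector [a + d + e, - d, - e],
             vector [- d, b + d + f, - f],
             vector [- e, - f, c + e + f]]"

definition gram_matrix :: "('n::finite \<Rightarrow> real^'n) \<Rightarrow> real^'n^'n" where
  "gram_matrix v = (\<chi> i j. v i \<bullet> v j)"

definition lattice_span :: "('n::finite \<Rightarrow> real^'n) \<Rightarrow> (real^'n) set" where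
  "lattice_span v = {\<Sum>i\<in>UNIV. of_int (k i) *\<^sub>R v i | k :: 'n \<Rightarrow> int. True}"

definition voronoi_cell :: "'a::euclidean_space set \<Rightarrow> 'a set" where
  "voronoi_cell L = {x. \<forall>y\<in>L. dist x 0 \<le> dist x y}"

text \<open>
  The two-dimensional Lebesgue measure of a set contained in a plane of space, computed in
  Cartesian coordinates of such a plane. Any two choices of coordinates differ by an isometry
  of the coordinate plane, so the value does not depend on the choice.
\<close>
definition planar_area :: "(real^3) set \<Rightarrow> real" where
  "planar_area C =
     (let g = (SOME g :: real^2 \<Rightarrow> real^3. (\<forall>u v. dist (g u) (g v) = dist u v) \<and> C \<subseteq> range g)
      in measure lebesgue (g -` C))"

text \<open>Meaningful for full-dimensional polytopes, which have finitely many facets.\<close>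
definition surface_area :: "(real^3) set \<Rightarrow> real" where
  "surface_area P = (\<Sum>C | C facet_of P. planar_area C)"

text \<open>
  A basis with a prescribed Gram matrix is unique up to an isometry of space, so the choice of
  the basis does not affect the surface area. The value is only meaningful for nonnegative
  parameters whose Selling matrix has positive determinant; a vector family with that Gram
  matrix then exists and is automatically a basis. With \<open>b\<^sub>0 = - b\<^sub>1 - b\<^sub>2 - b\<^sub>3\<close>, the condition on
  the Gram matrix says exactly that \<open>- b\<^sub>i \<bullet> b\<^sub>j\<close>, for \<open>i < j\<close> in the order 01, 02, 03, 12, 13,
  23, are the six parameters.
\<close>
definition isoperimetric_quotient :: "real \<Rightarrow> real \<Rightarrow> real \<Rightarrow> real \<Rightarrow> real \<Rightarrow> real \<Rightarrow> real" where
  "isoperimetric_quotient a b c d e f =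
     (let v = (SOME v :: 3 \<Rightarrow> real^3. gram_matrix v = selling_matrix a b c d e f)
      in surface_area (voronoi_cell (lattice_span v))
           / det (selling_matrix a b c d e f) powr (1 / 3))"

end

theory Submission
  imports Defs
begin

text \<open>
  With \<open>s = sqrt (p + q)\<close> and \<open>t = sqrt q\<close>, any basis with Selling parameters \<open>p, q, q, q, q, p\<close> has, in a
  suitable orthonormal frame, the form \<open>(- s, 0, t)\<close>, \<open>(0, s, - t)\<close>, \<open>(0, - s, - t)\<close>, and it spans the
  body-centred tetragonal lattice of all \<open>(i * s, j * s, k * t)\<close> with \<open>i + j + k\<close> even. Its Voronoi cell is
  cut out by the vectors \<open>(\<plusminus> s, 0, \<plusminus> t)\<close>, \<open>(0, \<plusminus> s, \<plusminus> t)\<close>, \<open>(\<plusminus> s, \<plusminus> s, 0)\<close>, \<open>(0, 0, \<plusminus> 2 * t)\<close>, and up to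
  the symmetries of the frame it has three facets, each congruent to a region
  \<open>{(x, y). \<bar>x\<bar> \<le> A \<and> \<bar>y\<bar> \<le> B - k * \<bar>x\<bar>}\<close>. Up to a constant factor, the quotient is therefore an explicit
  function of \<open>m = s / (sqrt 2 * t)\<close>, whose derivative has the sign of \<open>m - 1\<close> for \<open>m > 1 / sqrt 2\<close>.
\<close>

section \<open>Planar area\<close>

text \<open>After subtracting \<open>g 0\<close> the map preserves norms, hence by polarization
  inner products. This forces it to be linear and injective, so its range is a translated
  two-dimensional subspace.\<close>

lemma range_isometry_plane:
  fixes g :: "real^2 \<Rightarrow> real^3"
  assumes "\<forall>u v. dist (g u) (g v) = dist u v"
  shows "affine (range g) \<and> aff_dim (range g) = 2"
proof -
  define L where "L = (\<lambda>u. g u - g 0)"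
  have iso: "dist (L u) (L v) = dist u v" for u v
    using assms by (simp add: L_def dist_norm)
  have norm: "norm (L u) = norm u" for u
    using iso[of u 0] by (simp add: L_def)
  have inner: "L u \<bullet> L v = u \<bullet> v" for u v
    using iso[of u v] norm[of u] norm[of v] unfolding dist_norm dot_norm_neg by simp
  have "linear L"
    \<comment> \<open>Vectors are equal once the relevant inner products agree, so linearity follows
      from preservation of inner products alone.\<close>
    unfolding linear_iff vector_eq[where 'a="real^3"]
    by (simp add: inner inner_add inner_commute algebra_simps)
  moreover have "inj L"
    using iso by (metis dist_eq_0_iff injI)
  ultimately have "dim (range L) = 2"
    by (simp add: dim_image_eq)
  moreover have sub: "subspace (range L)"
    using \<open>linear L\<close> by (simp add: linear_subspace_image)
  moreover have "range g = (+) (g 0) ` range L"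
    by (auto simp: L_def image_image)
  ultimately show ?thesis
    using affine_translation[of "range L" "g 0"] aff_dim_translation_eq[of "g 0" "range L"]
      aff_dim_subspace[OF sub] subspace_imp_affine[OF sub] by presburger
qed

text \<open>\<open>planar_area\<close> takes its chart by Hilbert choice. Since \<open>C\<close>
  spans a plane, any two charts parametrize that same plane and differ by an isometry of
  \<open>real^2\<close>, which preserves Lebesgue measure.\<close>

lemma planar_area_eq:
  fixes g :: "real^2 \<Rightarrow> real^3"
  assumes g: "\<forall>u v. dist (g u) (g v) = dist u v" and C: "C \<subseteq> range g"
    and dim: "aff_dim C = 2" and meas: "g -` C \<in> lmeasurable"
  shows "planar_area C = measure lebesgue (g -` C)"
proof -
  define h where "h = (SOME g :: real^2 \<Rightarrow> real^3. (\<forall>u v. dist (g u) (g v) = dist u v) \<and> C \<subseteq> range g)"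
  have h: "\<forall>u v. dist (h u) (h v) = dist u v" and hC: "C \<subseteq> range h"
    using someI[of "\<lambda>g :: real^2 \<Rightarrow> real^3. (\<forall>u v. dist (g u) (g v) = dist u v) \<and> C \<subseteq> range g" g] g C
    unfolding h_def by blast+
  \<comment> \<open>The range is an affine plane containing \<open>C\<close>, and the affine hull of
    \<open>C\<close> already has dimension 2.\<close>
  have "range f = affine hull C" if "\<forall>u v. dist (f u) (f v) = dist u v" "C \<subseteq> range f"
    for f :: "real^2 \<Rightarrow> real^3"
    using range_isometry_plane[OF that(1)] aff_dim_eq_full_gen[OF that(2)] dim
    by (metis affine_hull_eq)
  then have rng: "range h = range g"
    using g h C hC by metis
  \<comment> \<open>Transition map from the chart \<open>g\<close> to the chosen chart
    \<open>h\<close>; removing its translation part leaves the orthogonal map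
    \<open>R\<close>.\<close>
  define T where "T = (\<lambda>u. inv h (g u))"
  have hT: "h (T u) = g u" for u
    using rng unfolding T_def by (metis f_inv_into_f rangeI)
  have T: "dist (T u) (T v) = dist u v" for u v
    using g h hT by metis
  define R where "R = (\<lambda>u. T u - T 0)"
  have R: "orthogonal_transformation R"
    unfolding orthogonal_transformation_isometry using T by (simp add: R_def dist_norm)
  have "inj h"
    using h by (metis dist_eq_0_iff injI)
  have "h -` C = T ` (g -` C)"
  proof (rule set_eqI)
    fix u
    show "u \<in> h -` C \<longleftrightarrow> u \<in> T ` (g -` C)"
      using hT \<open>inj h\<close> rng by (smt (verit) image_iff injD rangeI vimageD vimageI)
  qed
  also have "\<dots> = (+) (T 0) ` R ` (g -` C)"
    by (simp add: R_def image_image)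
  finally have "measure lebesgue (h -` C) = measure lebesgue (g -` C)"
    using measure_orthogonal_image[OF R meas] by (simp only: measure_translation)
  then show ?thesis
    by (simp add: planar_area_def h_def Let_def)
qed

lemma measurable_vector2: "(\<lambda>(x, y). vector [x, y] :: real^2) \<in> borel_measurable lborel"
proof -
  have "continuous_on UNIV (\<lambda>z::real \<times> real. vector [fst z, snd z] :: real^2)"
  proof -
    have "(\<lambda>z::real \<times> real. vector [fst z, snd z] :: real^2) = (\<lambda>z. fst z *\<^sub>R axis 1 1 + snd z *\<^sub>R axis 2 1)"
      by (simp add: fun_eq_iff vec_eq_iff forall_2 axis_def)
    then show ?thesis
      by (simp only:) (intro continuous_intros)
  qed
  from borel_measurable_continuous_onI[OF this] show ?thesis
    by (simp add: case_prod_beta')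
qed

text \<open>Makes areas in \<open>real^2\<close> computable by slicing in the product measure;
  agreement on boxes suffices.\<close>

lemma lborel_vector2: "distr lborel borel (\<lambda>(x, y). vector [x, y] :: real^2) = lborel"
proof -
  have basis: "(Basis :: (real^2) set) = {axis 1 1, axis 2 1}"
    by (auto simp: Basis_vec_def UNIV_2)
  have ne: "axis 1 1 \<noteq> (axis 2 1 :: real^2)"
    by (simp add: axis_eq_axis)
  show ?thesis
  proof (rule lborel_eqI[symmetric])
    fix l u :: "real^2"
    assume le: "\<And>b. b \<in> Basis \<Longrightarrow> l \<bullet> b \<le> u \<bullet> b"
    have le': "l$1 \<le> u$1" "l$2 \<le> u$2"
      using le[of "axis 1 1"] le[of "axis 2 1"] by (simp_all add: basis inner_axis)
    have "(\<lambda>(x, y). vector [x, y]) -` box l u = {l$1<..<u$1} \<times> {l$2<..<u$2}"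
      by (auto simp: mem_box_cart forall_2)
    then have "emeasure (distr lborel borel (\<lambda>(x, y). vector [x, y])) (box l u)
        = emeasure (lborel \<Otimes>\<^sub>M lborel) ({l$1<..<u$1} \<times> {l$2<..<u$2})"
      using measurable_vector2 by (simp add: emeasure_distr lborel_prod)
    also have "\<dots> = ennreal (u$1 - l$1) * ennreal (u$2 - l$2)"
      using le' by (simp add: lborel.emeasure_pair_measure_Times)
    also have "\<dots> = (\<Prod>b\<in>Basis. (u - l) \<bullet> b)"
      using le' ne by (simp add: basis inner_axis ennreal_mult)
    finally show "emeasure (distr lborel borel (\<lambda>(x, y). vector [x, y])) (box l u)
        = (\<Prod>b\<in>Basis. (u - l) \<bullet> b)" .
  qed simp
qed

text \<open>One formula for all facet shapes: a rectangle for \<open>k = 0\<close>, a rhombus for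
  \<open>k * A = B\<close>, a hexagon in between. The slice over \<open>x\<close> is an interval of
  length \<open>2 * (B - k * |x|)\<close>, which is then integrated.\<close>

lemma hexagon_area:
  fixes A B k :: real
  assumes "0 \<le> A" "k * A \<le> B" "0 \<le> B"
  defines "S \<equiv> {y::real^2. \<bar>y$1\<bar> \<le> A \<and> \<bar>y$2\<bar> \<le> B - k * \<bar>y$1\<bar>}"
  shows "S \<in> lmeasurable" and "measure lebesgue S = 4 * A * B - 2 * k * A\<^sup>2"
proof -
  define f where "f = (\<lambda>x. 2 * (B - k * \<bar>x\<bar>))"
  have nonneg: "0 \<le> f x" if "x \<in> {-A..A}" for x
  proof (cases "k \<ge> 0")
    case True
    then have "k * \<bar>x\<bar> \<le> k * A" using that by (intro mult_left_mono) auto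
    then show ?thesis using assms by (simp add: f_def)
  next
    case False
    then show ?thesis using assms mult_nonpos_nonneg[of k "\<bar>x\<bar>"] by (simp add: f_def)
  qed
  have closed: "closed S"
    unfolding S_def by (intro closed_Collect_conj closed_Collect_le continuous_intros)
  then have S: "S \<in> sets borel" by simp
  \<comment> \<open>The kink of \<open>|x|\<close> at 0 splits the integral; on each half the
    antiderivative is a polynomial.\<close>
  have I1: "(f has_integral (\<lambda>x. 2 * B * x - k * x\<^sup>2) A - (\<lambda>x. 2 * B * x - k * x\<^sup>2) 0) {0..A}"
    by (rule fundamental_theorem_of_calculus)
      (auto simp: assms f_def has_real_derivative_iff_has_vector_derivative[symmetric] intro!: derivative_eq_intros)
  have I2: "(f has_integral (\<lambda>x. 2 * B * x + k * x\<^sup>2) 0 - (\<lambda>x. 2 * B * x + k * x\<^sup>2) (-A)) {-A..0}"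
    by (rule fundamental_theorem_of_calculus)
      (auto simp: assms f_def has_real_derivative_iff_has_vector_derivative[symmetric] intro!: derivative_eq_intros)
  have I: "(f has_integral 4 * A * B - 2 * k * A\<^sup>2) {-A..A}"
    using has_integral_combine[OF _ _ I2 I1] assms by (simp add: algebra_simps)
  have vS: "(\<lambda>(x, y). vector [x, y]) -` S = {z. \<bar>fst z\<bar> \<le> A \<and> \<bar>snd z\<bar> \<le> B - k * \<bar>fst z\<bar>}"
    by (auto simp: S_def)
  have "closed ({z. \<bar>fst z\<bar> \<le> A \<and> \<bar>snd z\<bar> \<le> B - k * \<bar>fst z\<bar>} :: (real \<times> real) set)"
    by (intro closed_Collect_conj closed_Collect_le continuous_intros)
  then have vS': "(\<lambda>(x, y). vector [x, y]) -` S \<in> sets (lborel \<Otimes>\<^sub>M lborel :: (real \<times> real) measure)"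
    unfolding vS lborel_prod by simp
  have "emeasure lborel S = emeasure (distr lborel borel (\<lambda>(x, y). vector [x, y] :: real^2)) S"
    by (simp add: lborel_vector2)
  also have "\<dots> = emeasure (lborel \<Otimes>\<^sub>M lborel) ((\<lambda>(x, y). vector [x, y]) -` S)"
    using S measurable_vector2 by (simp add: emeasure_distr lborel_prod)
  also have "\<dots> = (\<integral>\<^sup>+x. emeasure lborel (Pair x -` ((\<lambda>(x, y). vector [x, y]) -` S)) \<partial>lborel)"
    by (rule lborel.emeasure_pair_measure_alt[OF vS'])
  also have "\<dots> = (\<integral>\<^sup>+x. ennreal (f x) * indicator {-A..A} x \<partial>lborel)"
  proof (rule nn_integral_cong)
    fix x
    have "Pair x -` ((\<lambda>(x, y). vector [x, y]) -` S)
        = (if x \<in> {-A..A} then {-(B - k * \<bar>x\<bar>)..B - k * \<bar>x\<bar>} else {})"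
      by (auto simp: S_def)
    then show "emeasure lborel (Pair x -` ((\<lambda>(x, y). vector [x, y]) -` S)) = ennreal (f x) * indicator {-A..A} x"
      using nonneg[of x] by (auto simp: f_def)
  qed
  also have "\<dots> = ennreal (4 * A * B - 2 * k * A\<^sup>2)"
    using nonneg I by (rule nn_integral_has_integral_lebesgue')
  finally have em: "emeasure lborel S = ennreal (4 * A * B - 2 * k * A\<^sup>2)" .
  have "0 \<le> 4 * A * B - 2 * k * A\<^sup>2"
    using has_integral_nonneg[OF I] nonneg by blast
  then have "measure lborel S = 4 * A * B - 2 * k * A\<^sup>2"
    using em by (simp add: measure_def)
  then show "measure lebesgue S = 4 * A * B - 2 * k * A\<^sup>2"
    using S by simp
  show "S \<in> lmeasurable"
    using em S by (simp add: fmeasurable_def)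
qed

section \<open>Facets\<close>

text \<open>The strictness condition says that the midpoint of each \<open>w j\<close> satisfies all the other inequalities
  strictly, hence no inequality is redundant.\<close>
lemma facets_halfspaces:
  fixes w :: "'i \<Rightarrow> 'a::euclidean_space"
  assumes fin: "finite I"
    and strict: "\<And>i j. i \<in> I \<Longrightarrow> j \<in> I \<Longrightarrow> i \<noteq> j \<Longrightarrow> w i \<bullet> w j < w j \<bullet> w j"
    and nz: "\<And>i. i \<in> I \<Longrightarrow> w i \<noteq> 0"
    and P: "P = {x. \<forall>i\<in>I. w i \<bullet> x \<le> w i \<bullet> w i / 2}"
  shows "bij_betw (\<lambda>i. P \<inter> {x. w i \<bullet> x = w i \<bullet> w i / 2}) I {C. C facet_of P}"
    and "aff_dim P = DIM('a)"
proof -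
  define B where "B = (\<lambda>v::'a. {x. v \<bullet> x \<le> v \<bullet> v / 2})"
  \<comment> \<open>All inequalities are strict at 0, so \<open>P\<close> contains an open
    neighbourhood of 0 and is full-dimensional.\<close>
  define U where "U = (\<Inter>i\<in>I. {x. w i \<bullet> x < w i \<bullet> w i / 2})"
  have "open U"
    unfolding U_def using fin by (intro open_INT ballI open_halfspace_lt)
  moreover have "0 \<in> U" "U \<subseteq> P"
    using nz by (auto simp: U_def P less_imp_le)
  ultimately have int: "interior P \<noteq> {}"
    using interior_maximal by blast
  show dim: "aff_dim P = DIM('a)"
    using int aff_dim_nonempty_interior by blast
  then have full: "affine hull P = UNIV"
    by (simp add: aff_dim_eq_full)
  have on: "w i /\<^sub>R 2 \<in> P" if "i \<in> I" for i
    using strict[OF that] that by (auto simp: P inner_commute) (metis order_less_imp_le order_refl)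
  have out: "\<exists>x. x \<notin> B (w i) \<and> (\<forall>j\<in>I. j \<noteq> i \<longrightarrow> x \<in> B (w j))" if i: "i \<in> I" for i
  proof -
    have lim: "((\<lambda>e. (1 + e) * (w j \<bullet> w i)) \<longlongrightarrow> (1 + 0) * (w j \<bullet> w i)) (at_right 0)" for j
      by (intro tendsto_intros)
    have "\<forall>\<^sub>F e in at_right 0. (1 + e) * (w j \<bullet> w i) < w j \<bullet> w j" if "j \<in> I" "j \<noteq> i" for j
      by (rule order_tendstoD(2)[OF lim]) (use strict[OF i that(1)] that in \<open>simp add: inner_commute\<close>)
    then have "\<forall>\<^sub>F e in at_right 0. \<forall>j\<in>I-{i}. (1 + e) * (w j \<bullet> w i) < w j \<bullet> w j"
      using fin by (intro eventually_ball_finite) auto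
    moreover have "\<forall>\<^sub>F e in at_right (0::real). 0 < e"
      by (rule eventually_at_right_less)
    ultimately have "\<forall>\<^sub>F e in at_right (0::real). (\<forall>j\<in>I-{i}. (1 + e) * (w j \<bullet> w i) < w j \<bullet> w j) \<and> 0 < e"
      by eventually_elim simp
    then obtain e::real where e: "\<forall>j\<in>I-{i}. (1 + e) * (w j \<bullet> w i) < w j \<bullet> w j" "0 < e"
      using eventually_happens by (metis (mono_tags, lifting) trivial_limit_at_right_real)
    have "0 < e * (w i \<bullet> w i)"
      using nz[OF i] e(2) by simp
    then have "((1 + e) / 2) *\<^sub>R w i \<notin> B (w i)"
      using e(2) by (simp add: B_def field_simps not_le del: inner_gt_zero_iff zero_less_mult_iff mult_less_0_iff)
    moreover have "\<forall>j\<in>I. j \<noteq> i \<longrightarrow> ((1 + e) / 2) *\<^sub>R w i \<in> B (w j)"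
      using e(1) by (auto simp: B_def intro: less_imp_le)
    ultimately show ?thesis by blast
  qed
  \<comment> \<open>\<open>facet_of_polyhedron_explicit\<close> indexes facets by halfspaces, so the
    normal vector has to be recovered as a function \<open>a\<close> of its halfspace.\<close>
  have inj: "inj_on B (w ` I)"
    using out by (smt (verit) image_iff inj_onI)
  define a where "a = inv_into (w ` I) B"
  have a: "a (B (w i)) = w i" if "i \<in> I" for i
    using inj that by (simp add: a_def)
  have facet: "C facet_of P \<longleftrightarrow> (\<exists>h\<in>B ` w ` I. C = P \<inter> {x. a h \<bullet> x = a h \<bullet> a h / 2})" for C
    unfolding Bex_def
  proof (rule facet_of_polyhedron_explicit)
    show "finite (B ` w ` I)" using fin by simp
    have PB: "P = \<Inter> (B ` w ` I)"
      by (auto simp: P B_def)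
    then show "P = affine hull P \<inter> \<Inter> (B ` w ` I)"
      unfolding full by simp
    show "a h \<noteq> 0 \<and> h = {x. a h \<bullet> x \<le> a h \<bullet> a h / 2}" if h: "h \<in> B ` w ` I" for h
      using h a nz by (auto simp: B_def)
    show "P \<subset> affine hull P \<inter> \<Inter> F" if F: "F \<subset> B ` w ` I" for F
    proof -
      obtain i where i: "i \<in> I" "B (w i) \<notin> F"
        using F by blast
      obtain x where x: "x \<notin> B (w i)" "\<forall>j\<in>I. j \<noteq> i \<longrightarrow> x \<in> B (w j)"
        using out[OF i(1)] by blast
      have "x \<in> \<Inter> F"
      proof
        fix h assume "h \<in> F"
        then obtain j where "j \<in> I" "h = B (w j)" using F by blast
        with \<open>h \<in> F\<close> i x show "x \<in> h" by metis
      qed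
      moreover have "x \<notin> P" using i(1) x(1) by (auto simp: P B_def)
      moreover have "P \<subseteq> \<Inter> F" using PB F by blast
      ultimately show ?thesis unfolding full by blast
    qed
  qed
  \<comment> \<open>The midpoint of \<open>w i\<close> lies on its own facet and on no other, which
    keeps the facets distinct.\<close>
  have "w i /\<^sub>R 2 \<notin> {x. w j \<bullet> x = w j \<bullet> w j / 2}" if "i \<in> I" "j \<in> I" "i \<noteq> j" for i j
    using strict[OF that] by (simp add: inner_commute)
  then have "inj_on (\<lambda>i. P \<inter> {x. w i \<bullet> x = w i \<bullet> w i / 2}) I"
  proof -
    assume *: "\<And>i j. i \<in> I \<Longrightarrow> j \<in> I \<Longrightarrow> i \<noteq> j \<Longrightarrow> w i /\<^sub>R 2 \<notin> {x. w j \<bullet> x = w j \<bullet> w j / 2}"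
    have "w i /\<^sub>R 2 \<in> P \<inter> {x. w i \<bullet> x = w i \<bullet> w i / 2}" if "i \<in> I" for i
      using on[OF that] by simp
    then show ?thesis using * unfolding inj_on_def by blast
  qed
  moreover have "(\<lambda>i. P \<inter> {x. w i \<bullet> x = w i \<bullet> w i / 2}) ` I = {C. C facet_of P}"
    unfolding facet using a by (auto simp: image_iff)
  ultimately show "bij_betw (\<lambda>i. P \<inter> {x. w i \<bullet> x = w i \<bullet> w i / 2}) I {C. C facet_of P}"
    by (simp add: bij_betw_def)
qed

section \<open>Orthonormal frames and the facet areas of the body-centred tetragonal cell\<close>

definition orthonormal3 :: "real^3 \<Rightarrow> real^3 \<Rightarrow> real^3 \<Rightarrow> bool" where
  "orthonormal3 a b c \<longleftrightarrow> a \<bullet> a = 1 \<and> b \<bullet> b = 1 \<and> c \<bullet> c = 1 \<and> a \<bullet> b = 0 \<and> a \<bullet> c = 0 \<and> b \<bullet> c = 0"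

lemma orthonormal3_inner:
  assumes "orthonormal3 a b c"
  shows "a \<bullet> a = 1" "b \<bullet> b = 1" "c \<bullet> c = 1" "a \<bullet> b = 0" "b \<bullet> a = 0"
    "a \<bullet> c = 0" "c \<bullet> a = 0" "b \<bullet> c = 0" "c \<bullet> b = 0"
  using assms by (simp_all add: orthonormal3_def inner_commute)

lemma orthonormal3_expand:
  assumes "orthonormal3 a b c"
  shows "x = (x \<bullet> a) *\<^sub>R a + (x \<bullet> b) *\<^sub>R b + (x \<bullet> c) *\<^sub>R c"
proof -
  note o = orthonormal3_inner[OF assms]
  have ne: "a \<noteq> b" "a \<noteq> c" "b \<noteq> c"
    using o by auto
  have orth: "pairwise orthogonal {a, b, c}"
    using o by (auto simp: pairwise_insert orthogonal_def)
  have "independent {a, b, c}"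
    using orth o by (intro pairwise_orthogonal_independent) auto
  then have "span {a, b, c} = UNIV"
    using ne card_ge_dim_independent[of "{a, b, c}" UNIV] by auto
  then have "(\<Sum>i\<in>{a, b, c}. (x \<bullet> i) *\<^sub>R i) = x"
    using orth o by (intro orthonormal_basis_expand) (auto simp: norm_eq_1)
  then show ?thesis
    using ne by (simp add: add.assoc)
qed

text \<open>Each facet area is computed in a frame whose third vector is normal to the facet; the
  first two vectors then provide an isometric chart of its plane.\<close>

lemma planar_area_coords:
  assumes o: "orthonormal3 a b n" and C: "C \<subseteq> {x. x \<bullet> n = c}" and dim: "aff_dim C = 2"
    and meas: "{y::real^2. (y$1) *\<^sub>R a + (y$2) *\<^sub>R b + c *\<^sub>R n \<in> C} \<in> lmeasurable"
  shows "planar_area C = measure lebesgue {y::real^2. (y$1) *\<^sub>R a + (y$2) *\<^sub>R b + c *\<^sub>R n \<in> C}"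
proof -
  define g :: "real^2 \<Rightarrow> real^3" where "g = (\<lambda>y. (y$1) *\<^sub>R a + (y$2) *\<^sub>R b + c *\<^sub>R n)"
  have "norm (g u - g v) = norm (u - v)" for u v
  proof -
    have "g u - g v = ((u - v)$1) *\<^sub>R a + ((u - v)$2) *\<^sub>R b"
      by (simp add: g_def algebra_simps)
    moreover have "(x *\<^sub>R a + y *\<^sub>R b) \<bullet> (x *\<^sub>R a + y *\<^sub>R b) = x * x + y * y" for x y
      by (simp add: inner_left_distrib inner_right_distrib orthonormal3_inner[OF o])
    moreover have "(u - v) \<bullet> (u - v) = (u - v)$1 * (u - v)$1 + (u - v)$2 * (u - v)$2"
      by (simp add: inner_vec_def sum_2)
    ultimately show ?thesis
      by (simp add: norm_eq)
  qed
  then have "\<forall>u v. dist (g u) (g v) = dist u v"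
    by (simp add: dist_norm)
  moreover have "C \<subseteq> range g"
  proof
    fix x assume "x \<in> C"
    then have "x = g (vector [x \<bullet> a, x \<bullet> b])"
      using orthonormal3_expand[OF o, of x] C by (auto simp: g_def)
    then show "x \<in> range g" by blast
  qed
  moreover have "{y::real^2. (y$1) *\<^sub>R a + (y$2) *\<^sub>R b + c *\<^sub>R n \<in> C} = g -` C"
    by (auto simp: g_def)
  ultimately show ?thesis
    using planar_area_eq dim meas by simp
qed

text \<open>The Voronoi cell, for \<open>t \<le> s\<close>, of the body-centred tetragonal lattice of the vectors
  \<open>(i * s, j * s, k * t)\<close> with \<open>i + j + k\<close> even, in the coordinates of the frame \<open>a, b, c\<close>.\<close>
definition bct_cell :: "real \<Rightarrow> real \<Rightarrow> real^3 \<Rightarrow> real^3 \<Rightarrow> real^3 \<Rightarrow> (real^3) set" where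
  "bct_cell s t a b c = {x. \<bar>x \<bullet> c\<bar> \<le> t \<and> \<bar>x \<bullet> a\<bar> + \<bar>x \<bullet> b\<bar> \<le> s \<and>
     s * \<bar>x \<bullet> a\<bar> + t * \<bar>x \<bullet> c\<bar> \<le> (s\<^sup>2 + t\<^sup>2) / 2 \<and> s * \<bar>x \<bullet> b\<bar> + t * \<bar>x \<bullet> c\<bar> \<le> (s\<^sup>2 + t\<^sup>2) / 2}"

lemma bct_cell_comb:
  assumes "orthonormal3 a b c"
  shows "x *\<^sub>R a + y *\<^sub>R b + z *\<^sub>R c \<in> bct_cell s t a b c \<longleftrightarrow>
    \<bar>z\<bar> \<le> t \<and> \<bar>x\<bar> + \<bar>y\<bar> \<le> s \<and>
     s * \<bar>x\<bar> + t * \<bar>z\<bar> \<le> (s\<^sup>2 + t\<^sup>2) / 2 \<and> s * \<bar>y\<bar> + t * \<bar>z\<bar> \<le> (s\<^sup>2 + t\<^sup>2) / 2"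
  by (simp add: bct_cell_def inner_left_distrib orthonormal3_inner[OF assms])

text \<open>At height \<open>t\<close> the two slanted bounds become \<open>|x| \<le> u\<close> and
  \<open>|y| \<le> u\<close>, and they imply \<open>|x| + |y| \<le> s\<close>. The facet is a square
  of side \<open>2 * u\<close>.\<close>

lemma bct_top_area:
  assumes o: "orthonormal3 a b c" and st: "0 < t" "t < s"
    and C: "C = bct_cell s t a b c \<inter> {x. (2 * t) *\<^sub>R c \<bullet> x = (2 * t) *\<^sub>R c \<bullet> (2 * t) *\<^sub>R c / 2}"
    and dim: "aff_dim C = 2"
  shows "planar_area C = (s\<^sup>2 - t\<^sup>2)\<^sup>2 / s\<^sup>2"
proof -
  \<comment> \<open>Solves \<open>s * u + t * t = (s\<^sup>2 + t\<^sup>2) / 2\<close>.\<close>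
  define u where "u = (s\<^sup>2 - t\<^sup>2) / (2 * s)"
  have su: "s * u = (s\<^sup>2 - t\<^sup>2) / 2"
    using st by (simp add: u_def)
  have tt: "t\<^sup>2 < s\<^sup>2" "t\<^sup>2 > 0"
    using st by (auto intro: power_strict_mono)
  have u: "0 \<le> u" "2 * u \<le> s"
    using st tt by (auto simp: u_def field_simps power2_eq_square)
  have C': "C \<subseteq> {x. x \<bullet> c = t}"
    using st by (auto simp: C orthonormal3_inner[OF o] inner_commute)
  have "{y::real^2. (y$1) *\<^sub>R a + (y$2) *\<^sub>R b + t *\<^sub>R c \<in> C}
      = {y. \<bar>y$1\<bar> \<le> u \<and> \<bar>y$2\<bar> \<le> u - 0 * \<bar>y$1\<bar>}"
  proof -
    have "s * \<bar>x\<bar> + t * \<bar>t\<bar> \<le> (s\<^sup>2 + t\<^sup>2) / 2 \<longleftrightarrow> \<bar>x\<bar> \<le> u" for x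
    proof -
      have "s * \<bar>x\<bar> + t * \<bar>t\<bar> \<le> (s\<^sup>2 + t\<^sup>2) / 2 \<longleftrightarrow> s * \<bar>x\<bar> \<le> s * u"
        using st by (simp add: su power2_eq_square field_simps)
      then show ?thesis using st by simp
    qed
    then show ?thesis
      using st u by (auto simp: C bct_cell_comb[OF o] inner_right_distrib orthonormal3_inner[OF o])
  qed
  with planar_area_coords[OF o C' dim] hexagon_area[of u 0 u] u
  have "planar_area C = 4 * u\<^sup>2"
    by (simp add: power2_eq_square)
  then show ?thesis
    using st by (simp add: u_def power_divide power_mult_distrib)
qed

text \<open>The cell conditions on a side facet, multiplied by \<open>s\<close> or \<open>t\<close>
  so that they become linear in \<open>S = s\<^sup>2\<close>, \<open>T = t\<^sup>2\<close>,
  \<open>p = s * (h * x)\<close> and \<open>q = t * |z|\<close>. The last two conditions imply the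
  others.\<close>

lemma side_region:
  fixes p q S T :: real
  assumes "T \<le> S" "0 < T" "0 \<le> q"
  shows "q \<le> T \<and> \<bar>S / 2 + p\<bar> + \<bar>S / 2 - p\<bar> \<le> S \<and> \<bar>S / 2 + p\<bar> + q \<le> (S + T) / 2 \<and> \<bar>S / 2 - p\<bar> + q \<le> (S + T) / 2
   \<longleftrightarrow> \<bar>p\<bar> + q \<le> T / 2"
  using assms by (auto simp: abs_if field_simps split: if_splits)

text \<open>The same linearization with \<open>p = s * t * \<xi>\<close> and
  \<open>Y = s * |y|\<close>. The first and third conditions bound \<open>p\<close> from below and
  above; the second and fourth give \<open>Y \<le> S / 2 - p\<close> and
  \<open>Y \<le> S / 2 + p\<close>.\<close>

lemma slant_region:
  fixes p Y S T :: real
  assumes "T \<le> S" "0 < T" "0 \<le> Y"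
  shows "\<bar>T / 2 - p\<bar> \<le> T \<and> \<bar>S / 2 + p\<bar> + Y \<le> S \<and> \<bar>S / 2 + p\<bar> + \<bar>T / 2 - p\<bar> \<le> (S + T) / 2 \<and> Y + \<bar>T / 2 - p\<bar> \<le> (S + T) / 2
   \<longleftrightarrow> \<bar>p\<bar> \<le> T / 2 \<and> Y \<le> S / 2 - \<bar>p\<bar>"
  using assms by (auto simp: abs_if field_simps split: if_splits)
text \<open>The facet is a rhombus with half-diagonals \<open>h * t\<^sup>2 / s\<close> and
  \<open>t / 2\<close>, seen after rotating the frame by 45 degrees about \<open>c\<close>.\<close>

lemma bct_side_area:
  assumes o: "orthonormal3 a b c" and st: "0 < t" "t \<le> s"
    and C: "C = bct_cell s t a b c \<inter> {x. (s *\<^sub>R a + s *\<^sub>R b) \<bullet> x = (s *\<^sub>R a + s *\<^sub>R b) \<bullet> (s *\<^sub>R a + s *\<^sub>R b) / 2}"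
    and dim: "aff_dim C = 2"
  shows "planar_area C = t^3 / (sqrt 2 * s)"
proof -
  \<comment> \<open>Cosine of 45 degrees; \<open>h * s\<close> is then the distance of the facet
    plane from the origin.\<close>
  define h where "h = 1 / sqrt (2::real)"
  have h: "0 < h" "h * h = 1 / 2"
    by (simp_all add: h_def)
  have tt: "t\<^sup>2 \<le> s\<^sup>2" "0 < t\<^sup>2"
    using st by (auto intro: power_mono)
  have o': "orthonormal3 (h *\<^sub>R a - h *\<^sub>R b) c (h *\<^sub>R a + h *\<^sub>R b)"
    using h by (simp add: orthonormal3_def inner_left_distrib inner_right_distrib inner_diff_left inner_diff_right orthonormal3_inner[OF o])
  have C': "C \<subseteq> {x. x \<bullet> (h *\<^sub>R a + h *\<^sub>R b) = h * s}"
  proof (intro subsetI CollectI)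
    fix x assume "x \<in> C"
    then have "s * (x \<bullet> a + x \<bullet> b) = s * s"
      by (simp add: C orthonormal3_inner[OF o] inner_commute inner_left_distrib inner_right_distrib algebra_simps)
    then have "x \<bullet> a + x \<bullet> b = s"
      using st by simp
    then show "x \<bullet> (h *\<^sub>R a + h *\<^sub>R b) = h * s"
      by (simp add: inner_right_distrib flip: distrib_left)
  qed
  have "{y::real^2. (y$1) *\<^sub>R (h *\<^sub>R a - h *\<^sub>R b) + (y$2) *\<^sub>R c + (h * s) *\<^sub>R (h *\<^sub>R a + h *\<^sub>R b) \<in> C}
      = {y. \<bar>y$1\<bar> \<le> h * t\<^sup>2 / s \<and> \<bar>y$2\<bar> \<le> t / 2 - h * s / t * \<bar>y$1\<bar>}"
  proof -
    have "x *\<^sub>R (h *\<^sub>R a - h *\<^sub>R b) + z *\<^sub>R c + (h * s) *\<^sub>R (h *\<^sub>R a + h *\<^sub>R b) \<in> C \<longleftrightarrow>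
       \<bar>x\<bar> \<le> h * t\<^sup>2 / s \<and> \<bar>z\<bar> \<le> t / 2 - h * s / t * \<bar>x\<bar>" (is "?p \<in> C \<longleftrightarrow> ?r") for x z
    proof -
      have p: "?p = (s / 2 + h * x) *\<^sub>R a + (s / 2 - h * x) *\<^sub>R b + z *\<^sub>R c"
      proof -
        have hs: "h * (h * s) = s / 2"
          using h(2) by (simp flip: mult.assoc)
        show ?thesis
          by (simp add: algebra_simps hs)
      qed
      have "?p \<in> C \<longleftrightarrow> ?p \<in> bct_cell s t a b c"
        unfolding p by (simp add: C inner_right_distrib inner_left_distrib orthonormal3_inner[OF o] algebra_simps)
      also have "\<dots> \<longleftrightarrow> \<bar>z\<bar> \<le> t \<and> \<bar>s / 2 + h * x\<bar> + \<bar>s / 2 - h * x\<bar> \<le> s \<and>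
         s * \<bar>s / 2 + h * x\<bar> + t * \<bar>z\<bar> \<le> (s\<^sup>2 + t\<^sup>2) / 2 \<and> s * \<bar>s / 2 - h * x\<bar> + t * \<bar>z\<bar> \<le> (s\<^sup>2 + t\<^sup>2) / 2"
        unfolding p by (rule bct_cell_comb[OF o])
      also have "\<dots> \<longleftrightarrow> s * (h * \<bar>x\<bar>) + t * \<bar>z\<bar> \<le> t\<^sup>2 / 2"
      proof -
        have eq: "s * \<bar>s / 2 + h * x\<bar> = \<bar>s\<^sup>2 / 2 + s * (h * x)\<bar>"
            "s * \<bar>s / 2 - h * x\<bar> = \<bar>s\<^sup>2 / 2 - s * (h * x)\<bar>"
            "s * (h * \<bar>x\<bar>) = \<bar>s * (h * x)\<bar>"
          using st h abs_mult[of s "s / 2 + h * x"] abs_mult[of s "s / 2 - h * x"]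
          by (simp_all add: power2_eq_square algebra_simps abs_mult)
        have i1: "\<bar>z\<bar> \<le> t \<longleftrightarrow> t * \<bar>z\<bar> \<le> t\<^sup>2"
          using st by (simp add: power2_eq_square)
        have "\<bar>s / 2 + h * x\<bar> + \<bar>s / 2 - h * x\<bar> \<le> s \<longleftrightarrow>
            s * (\<bar>s / 2 + h * x\<bar> + \<bar>s / 2 - h * x\<bar>) \<le> s * s"
          using order_less_le_trans[OF st] by (simp only: mult_le_cancel_left_pos)
        then have i2: "\<bar>s / 2 + h * x\<bar> + \<bar>s / 2 - h * x\<bar> \<le> s \<longleftrightarrow>
            \<bar>s\<^sup>2 / 2 + s * (h * x)\<bar> + \<bar>s\<^sup>2 / 2 - s * (h * x)\<bar> \<le> s\<^sup>2"
          by (simp only: distrib_left eq power2_eq_square)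
        show ?thesis
          unfolding i1 i2 eq using tt st by (intro side_region) auto
      qed
      also have "\<dots> \<longleftrightarrow> ?r"
      proof -
        have "\<bar>x\<bar> \<le> h * t\<^sup>2 / s \<longleftrightarrow> s * (h * \<bar>x\<bar>) \<le> t\<^sup>2 / 2"
        proof -
          have "\<bar>x\<bar> \<le> h * t\<^sup>2 / s \<longleftrightarrow> h * (s * \<bar>x\<bar>) \<le> h * (h * t\<^sup>2)"
            using st h(1) by (simp add: field_simps)
          also have "h * (h * t\<^sup>2) = t\<^sup>2 / 2"
            using h(2) by (simp flip: mult.assoc)
          finally show ?thesis by (simp add: mult.left_commute)
        qed
        moreover have "\<bar>z\<bar> \<le> t / 2 - h * s / t * \<bar>x\<bar> \<longleftrightarrow> s * (h * \<bar>x\<bar>) + t * \<bar>z\<bar> \<le> t\<^sup>2 / 2"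
          using st by (simp add: field_simps power2_eq_square)
        moreover have "0 \<le> t * \<bar>z\<bar>" using st by simp
        ultimately show ?thesis by auto
      qed
      finally show ?thesis .
    qed
    then show ?thesis by simp
  qed
  \<comment> \<open>This is \<open>k * A = B\<close> in \<open>hexagon_area\<close>: the slanted
    edges meet on the axis, so the hexagon degenerates to a rhombus.\<close>
  moreover have k: "h * s / t * (h * t\<^sup>2 / s) = t / 2"
    using st h(2) by (simp add: power2_eq_square)
  ultimately have "planar_area C = 4 * (h * t\<^sup>2 / s) * (t / 2) - 2 * (h * s / t) * (h * t\<^sup>2 / s)\<^sup>2"
    using planar_area_coords[OF o' C' dim] hexagon_area[of "h * t\<^sup>2 / s" "h * s / t" "t / 2"] st h(1)
    by simp
  also have "\<dots> = 4 * (h * t\<^sup>2 / s) * (t / 2) - 2 * (h * s / t * (h * t\<^sup>2 / s)) * (h * t\<^sup>2 / s)"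
    by (simp add: power2_eq_square)
  also have "\<dots> = h * t^3 / s"
    unfolding k by (simp add: power2_eq_square power3_eq_cube)
  finally have "planar_area C = h * t^3 / s" .
  then show ?thesis
    by (simp add: h_def)
qed

text \<open>The facet is a hexagon, seen after rotating the frame about \<open>b\<close> until its
  third vector is the facet normal.\<close>

lemma bct_slant_area:
  assumes o: "orthonormal3 a b c" and st: "0 < t" "t \<le> s"
    and C: "C = bct_cell s t a b c \<inter> {x. (s *\<^sub>R a + t *\<^sub>R c) \<bullet> x = (s *\<^sub>R a + t *\<^sub>R c) \<bullet> (s *\<^sub>R a + t *\<^sub>R c) / 2}"
    and dim: "aff_dim C = 2"
  shows "planar_area C = sqrt (s\<^sup>2 + t\<^sup>2) * (t - t^3 / (2 * s\<^sup>2))"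
proof -
  \<comment> \<open>Length of the lattice vector \<open>s *\<^sub>R a + t *\<^sub>R c\<close>; its
    bisecting plane has distance \<open>r / 2\<close> from the origin.\<close>
  define r where "r = sqrt (s\<^sup>2 + t\<^sup>2)"
  have r: "0 < r" "r * r = s\<^sup>2 + t\<^sup>2"
    using st by (simp_all add: r_def add_pos_pos)
  have o': "orthonormal3 ((t / r) *\<^sub>R a - (s / r) *\<^sub>R c) b ((s / r) *\<^sub>R a + (t / r) *\<^sub>R c)"
  proof -
    have "(t / r) * (t / r) + (s / r) * (s / r) = (s\<^sup>2 + t\<^sup>2) / (r * r)"
      using r(1) by (simp add: power2_eq_square field_simps)
    also have "\<dots> = 1" using r by (metis divide_self mult_pos_pos order_less_irrefl)
    finally show ?thesis
      by (simp add: orthonormal3_def inner_left_distrib inner_right_distrib inner_diff_left inner_diff_right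
          orthonormal3_inner[OF o] add.commute mult.commute)
  qed
  have C': "C \<subseteq> {x. x \<bullet> ((s / r) *\<^sub>R a + (t / r) *\<^sub>R c) = r / 2}"
  proof (intro subsetI CollectI)
    fix x assume "x \<in> C"
    then have "s * (x \<bullet> a) + t * (x \<bullet> c) = r * r / 2"
      by (simp add: C r(2) orthonormal3_inner[OF o] inner_commute inner_left_distrib inner_right_distrib power2_eq_square)
    then show "x \<bullet> ((s / r) *\<^sub>R a + (t / r) *\<^sub>R c) = r / 2"
      using r(1) by (simp add: inner_right_distrib field_simps)
  qed
  have "{y::real^2. (y$1) *\<^sub>R ((t / r) *\<^sub>R a - (s / r) *\<^sub>R c) + (y$2) *\<^sub>R b + (r / 2) *\<^sub>R ((s / r) *\<^sub>R a + (t / r) *\<^sub>R c) \<in> C}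
      = {y. \<bar>y$1\<bar> \<le> r * t / (2 * s) \<and> \<bar>y$2\<bar> \<le> s / 2 - t / r * \<bar>y$1\<bar>}"
  proof -
    have "x *\<^sub>R ((t / r) *\<^sub>R a - (s / r) *\<^sub>R c) + y *\<^sub>R b + (r / 2) *\<^sub>R ((s / r) *\<^sub>R a + (t / r) *\<^sub>R c) \<in> C \<longleftrightarrow>
       \<bar>x\<bar> \<le> r * t / (2 * s) \<and> \<bar>y\<bar> \<le> s / 2 - t / r * \<bar>x\<bar>" (is "?p \<in> C \<longleftrightarrow> ?r") for x y
    proof -
      \<comment> \<open>Rescaling by \<open>r\<close> removes the square root from the coordinates
        in the frame \<open>a\<close>, \<open>b\<close>, \<open>c\<close>.\<close>
      define \<xi> where "\<xi> = x / r"
      have x: "x = r * \<xi>" using r by (simp add: \<xi>_def)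
      have p: "?p = (s / 2 + t * \<xi>) *\<^sub>R a + y *\<^sub>R b + (t / 2 - s * \<xi>) *\<^sub>R c"
        using r(1) unfolding x by (simp add: algebra_simps)
      have "?p \<in> C \<longleftrightarrow> ?p \<in> bct_cell s t a b c"
        unfolding p by (simp add: C inner_right_distrib inner_left_distrib orthonormal3_inner[OF o] algebra_simps)
      also have "\<dots> \<longleftrightarrow> \<bar>t / 2 - s * \<xi>\<bar> \<le> t \<and> \<bar>s / 2 + t * \<xi>\<bar> + \<bar>y\<bar> \<le> s \<and>
         s * \<bar>s / 2 + t * \<xi>\<bar> + t * \<bar>t / 2 - s * \<xi>\<bar> \<le> (s\<^sup>2 + t\<^sup>2) / 2 \<and> s * \<bar>y\<bar> + t * \<bar>t / 2 - s * \<xi>\<bar> \<le> (s\<^sup>2 + t\<^sup>2) / 2"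
        unfolding p by (rule bct_cell_comb[OF o])
      also have "\<dots> \<longleftrightarrow> s * \<bar>\<xi>\<bar> \<le> t / 2 \<and> \<bar>y\<bar> \<le> s / 2 - t * \<bar>\<xi>\<bar>"
      proof -
        define p where "p = s * t * \<xi>"
        have eq: "t * \<bar>t / 2 - s * \<xi>\<bar> = \<bar>t\<^sup>2 / 2 - p\<bar>" "s * \<bar>s / 2 + t * \<xi>\<bar> = \<bar>s\<^sup>2 / 2 + p\<bar>"
            "t * (s * \<bar>\<xi>\<bar>) = \<bar>p\<bar>" "s * (t * \<bar>\<xi>\<bar>) = \<bar>p\<bar>"
          using st abs_mult[of t "t / 2 - s * \<xi>"] abs_mult[of s "s / 2 + t * \<xi>"]
          by (simp_all add: p_def power2_eq_square algebra_simps abs_mult)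
        have "\<bar>t / 2 - s * \<xi>\<bar> \<le> t \<longleftrightarrow> t * \<bar>t / 2 - s * \<xi>\<bar> \<le> t * t"
          using st by (simp only: mult_le_cancel_left_pos)
        then have i1: "\<bar>t / 2 - s * \<xi>\<bar> \<le> t \<longleftrightarrow> \<bar>t\<^sup>2 / 2 - p\<bar> \<le> t\<^sup>2"
          by (simp only: eq power2_eq_square)
        have "\<bar>s / 2 + t * \<xi>\<bar> + \<bar>y\<bar> \<le> s \<longleftrightarrow> s * (\<bar>s / 2 + t * \<xi>\<bar> + \<bar>y\<bar>) \<le> s * s"
          using order_less_le_trans[OF st] by (simp only: mult_le_cancel_left_pos)
        then have i2: "\<bar>s / 2 + t * \<xi>\<bar> + \<bar>y\<bar> \<le> s \<longleftrightarrow> \<bar>s\<^sup>2 / 2 + p\<bar> + s * \<bar>y\<bar> \<le> s\<^sup>2"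
          by (simp only: distrib_left eq power2_eq_square)
        have "s * \<bar>\<xi>\<bar> \<le> t / 2 \<longleftrightarrow> t * (s * \<bar>\<xi>\<bar>) \<le> t * (t / 2)"
          using st by (simp only: mult_le_cancel_left_pos)
        then have i3: "s * \<bar>\<xi>\<bar> \<le> t / 2 \<longleftrightarrow> \<bar>p\<bar> \<le> t\<^sup>2 / 2"
          unfolding eq by (simp add: power2_eq_square)
        have "\<bar>y\<bar> \<le> s / 2 - t * \<bar>\<xi>\<bar> \<longleftrightarrow> s * \<bar>y\<bar> \<le> s * (s / 2 - t * \<bar>\<xi>\<bar>)"
          using order_less_le_trans[OF st] by (simp only: mult_le_cancel_left_pos)
        then have i4: "\<bar>y\<bar> \<le> s / 2 - t * \<bar>\<xi>\<bar> \<longleftrightarrow> s * \<bar>y\<bar> \<le> s\<^sup>2 / 2 - \<bar>p\<bar>"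
          unfolding right_diff_distrib eq by (simp add: power2_eq_square)
        show ?thesis
          unfolding i1 i2 i3 i4 eq using st by (intro slant_region) (auto intro: power_mono)
      qed
      also have "\<dots> \<longleftrightarrow> ?r"
        using r st by (simp add: x abs_mult field_simps)
      finally show ?thesis .
    qed
    then show ?thesis by simp
  qed
  moreover have k: "t / r * (r * t / (2 * s)) = t * t / (2 * s)"
    using r(1) by simp
  moreover have "t * t / (2 * s) \<le> s / 2"
    using st mult_mono[of t s t s] by (simp add: field_simps)
  ultimately have "planar_area C = 4 * (r * t / (2 * s)) * (s / 2) - 2 * (t / r) * (r * t / (2 * s))\<^sup>2"
    using planar_area_coords[OF o' C' dim] hexagon_area[of "r * t / (2 * s)" "t / r" "s / 2"] st r(1)
    by simp
  also have "\<dots> = 4 * (r * t / (2 * s)) * (s / 2) - 2 * (t / r * (r * t / (2 * s))) * (r * t / (2 * s))"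
    by (simp only: power2_eq_square mult.assoc)
  also have "\<dots> = r * (t - t^3 / (2 * s\<^sup>2))"
    unfolding k using st by (simp add: power2_eq_square power3_eq_cube right_diff_distrib ac_simps)
  finally have "planar_area C = r * (t - t^3 / (2 * s\<^sup>2))" .
  then show ?thesis
    by (simp add: r_def)
qed

section \<open>Relevant vectors and the surface area of the cell\<close>

definition bct_vec :: "real \<Rightarrow> real \<Rightarrow> real^3 \<Rightarrow> real^3 \<Rightarrow> real^3 \<Rightarrow> int \<times> int \<times> int \<Rightarrow> real^3" where
  "bct_vec s t a b c = (\<lambda>(i, j, k). (s * i) *\<^sub>R a + (s * j) *\<^sub>R b + (t * k) *\<^sub>R c)"

text \<open>The coordinates of the Voronoi relevant vectors. For \<open>s = t\<close> the lattice is face-centred cubic,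
  and the two vectors along the axis are no longer relevant: their facets shrink to points.\<close>
definition bct_relevant :: "real \<Rightarrow> real \<Rightarrow> (int \<times> int \<times> int) set" where
  "bct_relevant s t =
     {(1,0,1), (1,0,-1), (-1,0,1), (-1,0,-1), (0,1,1), (0,1,-1), (0,-1,1), (0,-1,-1),
      (1,1,0), (1,-1,0), (-1,1,0), (-1,-1,0)} \<union> (if t < s then {(0,0,2), (0,0,-2)} else {})"

lemma bct_vec_inner:
  assumes "orthonormal3 a b c"
  shows "bct_vec s t a b c (i, j, k) \<bullet> bct_vec s t a b c (i', j', k') = s\<^sup>2 * (i * i' + j * j') + t\<^sup>2 * (k * k')"
    and "bct_vec s t a b c (i, j, k) \<bullet> x = s * i * (x \<bullet> a) + s * j * (x \<bullet> b) + t * k * (x \<bullet> c)"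
  using orthonormal3_inner[OF assms]
  by (simp_all add: bct_vec_def inner_left_distrib inner_right_distrib inner_commute power2_eq_square algebra_simps)

text \<open>A bound on a sum of absolute values is a conjunction over sign choices, and each choice
  is the halfspace of one relevant vector.\<close>

lemma bct_cell_relevant:
  assumes o: "orthonormal3 a b c" and st: "0 < t" "t \<le> s"
  shows "bct_cell s t a b c =
    {x. \<forall>i\<in>bct_relevant s t. bct_vec s t a b c i \<bullet> x \<le> bct_vec s t a b c i \<bullet> bct_vec s t a b c i / 2}"
proof -
  have "x \<in> bct_cell s t a b c \<longleftrightarrow>
     (\<forall>i\<in>bct_relevant s t. bct_vec s t a b c i \<bullet> x \<le> bct_vec s t a b c i \<bullet> bct_vec s t a b c i / 2)" for x
  proof -
    have tt: "t < s \<Longrightarrow> t\<^sup>2 \<le> s\<^sup>2" "t\<^sup>2 \<le> s\<^sup>2" "0 < t\<^sup>2"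
      using st by (auto intro: power_mono)
    have eq: "s * \<bar>x \<bullet> a\<bar> = \<bar>s * (x \<bullet> a)\<bar>" "s * \<bar>x \<bullet> b\<bar> = \<bar>s * (x \<bullet> b)\<bar>" "t * \<bar>x \<bullet> c\<bar> = \<bar>t * (x \<bullet> c)\<bar>"
      using st by (simp_all add: abs_mult)
    have "\<bar>x \<bullet> c\<bar> \<le> t \<longleftrightarrow> t * \<bar>x \<bullet> c\<bar> \<le> t * t"
      using st by (simp only: mult_le_cancel_left_pos)
    then have i1: "\<bar>x \<bullet> c\<bar> \<le> t \<longleftrightarrow> \<bar>t * (x \<bullet> c)\<bar> \<le> t\<^sup>2"
      by (simp only: eq power2_eq_square)
    have "\<bar>x \<bullet> a\<bar> + \<bar>x \<bullet> b\<bar> \<le> s \<longleftrightarrow> s * (\<bar>x \<bullet> a\<bar> + \<bar>x \<bullet> b\<bar>) \<le> s * s"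
      using order_less_le_trans[OF st] by (simp only: mult_le_cancel_left_pos)
    then have i2: "\<bar>x \<bullet> a\<bar> + \<bar>x \<bullet> b\<bar> \<le> s \<longleftrightarrow> \<bar>s * (x \<bullet> a)\<bar> + \<bar>s * (x \<bullet> b)\<bar> \<le> s\<^sup>2"
      by (simp only: distrib_left eq power2_eq_square)
    have "x \<in> bct_cell s t a b c \<longleftrightarrow> \<bar>t * (x \<bullet> c)\<bar> \<le> t\<^sup>2 \<and> \<bar>s * (x \<bullet> a)\<bar> + \<bar>s * (x \<bullet> b)\<bar> \<le> s\<^sup>2 \<and>
       \<bar>s * (x \<bullet> a)\<bar> + \<bar>t * (x \<bullet> c)\<bar> \<le> (s\<^sup>2 + t\<^sup>2) / 2 \<and> \<bar>s * (x \<bullet> b)\<bar> + \<bar>t * (x \<bullet> c)\<bar> \<le> (s\<^sup>2 + t\<^sup>2) / 2"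
      by (simp only: bct_cell_def mem_Collect_eq i1 i2 eq)
    \<comment> \<open>For \<open>s = t\<close> the bound on \<open>x \<bullet> c\<close> follows
      from a slanted one, since \<open>(s\<^sup>2 + t\<^sup>2) / 2 = t\<^sup>2\<close>.\<close>
    also have "\<dots> \<longleftrightarrow> (t < s \<longrightarrow> \<bar>t * (x \<bullet> c)\<bar> \<le> t\<^sup>2) \<and> \<bar>s * (x \<bullet> a)\<bar> + \<bar>s * (x \<bullet> b)\<bar> \<le> s\<^sup>2 \<and>
       \<bar>s * (x \<bullet> a)\<bar> + \<bar>t * (x \<bullet> c)\<bar> \<le> (s\<^sup>2 + t\<^sup>2) / 2 \<and> \<bar>s * (x \<bullet> b)\<bar> + \<bar>t * (x \<bullet> c)\<bar> \<le> (s\<^sup>2 + t\<^sup>2) / 2"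
      using st by (cases "t < s") (auto simp: power2_eq_square)
    also have "\<dots> \<longleftrightarrow> (\<forall>i\<in>bct_relevant s t. bct_vec s t a b c i \<bullet> x \<le> bct_vec s t a b c i \<bullet> bct_vec s t a b c i / 2)"
    proof -
      have ab: "\<bar>p\<bar> + \<bar>q\<bar> \<le> d \<longleftrightarrow> p + q \<le> d \<and> p - q \<le> d \<and> q - p \<le> d \<and> - p - q \<le> d" for p q d :: real
        by linarith
      have half: "bct_vec s t a b c (i, j, k) \<bullet> x \<le> bct_vec s t a b c (i, j, k) \<bullet> bct_vec s t a b c (i, j, k) / 2 \<longleftrightarrow>
          i * (s * (x \<bullet> a)) + j * (s * (x \<bullet> b)) + k * (t * (x \<bullet> c)) \<le> (s\<^sup>2 * (i * i + j * j) + t\<^sup>2 * (k * k)) / 2" for i j k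
        unfolding bct_vec_inner(1)[OF o] bct_vec_inner(2)[OF o, of s t _ _ _ x] by (simp add: mult_ac)
      show ?thesis
        unfolding ab abs_le_iff
        by (cases "t < s"; simp only: bct_relevant_def if_True if_False ball_Un ball_simps half; simp; blast)
    qed
    finally show ?thesis .
  qed
  then show ?thesis by blast
qed

text \<open>The gap between the two sides is \<open>s\<^sup>2 * P + t\<^sup>2 * Q\<close> with
  integers \<open>P\<close> and \<open>Q\<close>. Written as
  \<open>(s\<^sup>2 - t\<^sup>2) * P + t\<^sup>2 * (P + Q)\<close>, its sign reduces to a finite
  check on integer triples.\<close>

lemma bct_relevant_strict:
  assumes o: "orthonormal3 a b c" and st: "0 < t" "t \<le> s"
    and "i \<in> bct_relevant s t" "j \<in> bct_relevant s t" "i \<noteq> j"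
  shows "bct_vec s t a b c i \<bullet> bct_vec s t a b c j < bct_vec s t a b c j \<bullet> bct_vec s t a b c j"
proof -
  obtain i1 i2 i3 j1 j2 j3 where ij: "i = (i1, i2, i3)" "j = (j1, j2, j3)"
    by (metis prod_cases3)
  define P Q where "P = j1 * (j1 - i1) + j2 * (j2 - i2)" and "Q = j3 * (j3 - i3)"
  \<comment> \<open>The borderline \<open>P + Q = 0\<close> occurs, for instance, for
    \<open>i = (0,0,2)\<close> and \<open>j = (1,0,1)\<close>; there strictness comes from
    \<open>t < s\<close>.\<close>
  have PQ: "0 \<le> P \<and> (0 < P + Q \<or> t < s \<and> 0 < P \<and> 0 \<le> P + Q)"
  proof (cases "t < s")
    case True
    have "\<forall>(i1, i2, i3)\<in>bct_relevant s t. \<forall>(j1, j2, j3)\<in>bct_relevant s t. (i1, i2, i3) \<noteq> (j1, j2, j3) \<longrightarrow>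
       0 \<le> j1 * (j1 - i1) + j2 * (j2 - i2) \<and> (0 < j1 * (j1 - i1) + j2 * (j2 - i2) + j3 * (j3 - i3) \<or>
       0 < j1 * (j1 - i1) + j2 * (j2 - i2) \<and> 0 \<le> j1 * (j1 - i1) + j2 * (j2 - i2) + j3 * (j3 - i3))"
      using True by (simp add: bct_relevant_def)
    then show ?thesis
      using True assms(4-6) by (fastforce simp: ij P_def Q_def)
  next
    case False
    have "\<forall>(i1, i2, i3)\<in>bct_relevant s t. \<forall>(j1, j2, j3)\<in>bct_relevant s t. (i1, i2, i3) \<noteq> (j1, j2, j3) \<longrightarrow>
       0 \<le> j1 * (j1 - i1) + j2 * (j2 - i2) \<and> 0 < j1 * (j1 - i1) + j2 * (j2 - i2) + j3 * (j3 - i3)"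
      using False by (simp add: bct_relevant_def)
    then show ?thesis
      using assms(4-6) by (fastforce simp: ij P_def Q_def)
  qed
  have "bct_vec s t a b c j \<bullet> bct_vec s t a b c j - bct_vec s t a b c i \<bullet> bct_vec s t a b c j
      = (s\<^sup>2 - t\<^sup>2) * P + t\<^sup>2 * (P + Q)"
    by (simp add: ij bct_vec_inner(1)[OF o] P_def Q_def algebra_simps)
  also have "\<dots> > 0"
    using PQ
  proof (elim conjE disjE)
    assume "0 \<le> P" "0 < P + Q"
    then show ?thesis
      using st by (intro add_nonneg_pos mult_nonneg_nonneg mult_pos_pos) (auto intro: power_mono)
  next
    assume "t < s" "0 < P" "0 \<le> P + Q"
    then show ?thesis
      using st by (intro add_pos_nonneg mult_nonneg_nonneg mult_pos_pos) (auto intro: power_strict_mono)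
  qed
  finally show ?thesis by simp
qed

text \<open>Sign changes of the axes and the swap of \<open>a\<close> and \<open>b\<close> preserve
  the cell, so eight slanted, four side and two top facets reduce to the three computed areas. For
  \<open>s = t\<close> the top facets are absent and their term is 0.\<close>

lemma bct_surface_area:
  assumes o: "orthonormal3 a b c" and st: "0 < t" "t \<le> s"
  shows "surface_area (bct_cell s t a b c) =
    8 * (sqrt (s\<^sup>2 + t\<^sup>2) * (t - t^3 / (2 * s\<^sup>2))) + 4 * (t^3 / (sqrt 2 * s)) + 2 * ((s\<^sup>2 - t\<^sup>2)\<^sup>2 / s\<^sup>2)"
proof -
  let ?P = "bct_cell s t a b c" and ?w = "bct_vec s t a b c" and ?I = "bct_relevant s t"
  define F where "F = (\<lambda>i. ?P \<inter> {x. ?w i \<bullet> x = ?w i \<bullet> ?w i / 2})"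
  have fin: "finite ?I"
    by (simp add: bct_relevant_def)
  have nz: "?w i \<noteq> 0" if "i \<in> ?I" for i
  proof -
    have "?w i \<bullet> ?w i \<noteq> 0"
      using that st by (auto simp: bct_relevant_def bct_vec_inner(1)[OF o] sum_power2_eq_zero_iff simp del: inner_eq_zero_iff split: if_splits)
    then show ?thesis by auto
  qed
  note facets = facets_halfspaces[OF fin bct_relevant_strict[OF o st] nz bct_cell_relevant[OF o st], folded F_def]
  have dim: "aff_dim (F i) = 2" if "i \<in> ?I" for i
  proof -
    have "F i facet_of ?P"
      using facets(1) that by (auto simp: bij_betw_def)
    then show ?thesis
      using facets(2) by (simp add: facet_of_def)
  qed
  have slant: "planar_area (F (i, 0, k)) = sqrt (s\<^sup>2 + t\<^sup>2) * (t - t^3 / (2 * s\<^sup>2))"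
    "planar_area (F (0, i, k)) = sqrt (s\<^sup>2 + t\<^sup>2) * (t - t^3 / (2 * s\<^sup>2))"
    if "i \<in> {1, -1}" "k \<in> {1, -1}" for i k
  proof -
    have "orthonormal3 (i *\<^sub>R a) b (k *\<^sub>R c)" "orthonormal3 (i *\<^sub>R b) a (k *\<^sub>R c)"
      using that o by (auto simp: orthonormal3_def inner_commute)
    moreover have "F (i, 0, k) = bct_cell s t (i *\<^sub>R a) b (k *\<^sub>R c) \<inter>
        {x. (s *\<^sub>R i *\<^sub>R a + t *\<^sub>R k *\<^sub>R c) \<bullet> x = (s *\<^sub>R i *\<^sub>R a + t *\<^sub>R k *\<^sub>R c) \<bullet> (s *\<^sub>R i *\<^sub>R a + t *\<^sub>R k *\<^sub>R c) / 2}"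
      using that by (auto simp: F_def bct_vec_def bct_cell_def)
    moreover have "F (0, i, k) = bct_cell s t (i *\<^sub>R b) a (k *\<^sub>R c) \<inter>
        {x. (s *\<^sub>R i *\<^sub>R b + t *\<^sub>R k *\<^sub>R c) \<bullet> x = (s *\<^sub>R i *\<^sub>R b + t *\<^sub>R k *\<^sub>R c) \<bullet> (s *\<^sub>R i *\<^sub>R b + t *\<^sub>R k *\<^sub>R c) / 2}"
      using that by (auto simp: F_def bct_vec_def bct_cell_def add.commute)
    moreover have "(i, 0, k) \<in> ?I" "(0, i, k) \<in> ?I"
      using that by (auto simp: bct_relevant_def)
    ultimately show "planar_area (F (i, 0, k)) = sqrt (s\<^sup>2 + t\<^sup>2) * (t - t^3 / (2 * s\<^sup>2))"
      "planar_area (F (0, i, k)) = sqrt (s\<^sup>2 + t\<^sup>2) * (t - t^3 / (2 * s\<^sup>2))"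
      using bct_slant_area[OF _ st _ dim] by blast+
  qed
  have side: "planar_area (F (i, j, 0)) = t^3 / (sqrt 2 * s)" if "i \<in> {1, -1}" "j \<in> {1, -1}" for i j
  proof -
    have "orthonormal3 (i *\<^sub>R a) (j *\<^sub>R b) c"
      using that o by (auto simp: orthonormal3_def inner_commute)
    moreover have "F (i, j, 0) = bct_cell s t (i *\<^sub>R a) (j *\<^sub>R b) c \<inter>
        {x. (s *\<^sub>R i *\<^sub>R a + s *\<^sub>R j *\<^sub>R b) \<bullet> x = (s *\<^sub>R i *\<^sub>R a + s *\<^sub>R j *\<^sub>R b) \<bullet> (s *\<^sub>R i *\<^sub>R a + s *\<^sub>R j *\<^sub>R b) / 2}"
      using that by (auto simp: F_def bct_vec_def bct_cell_def)
    moreover have "(i, j, 0) \<in> ?I"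
      using that by (auto simp: bct_relevant_def)
    ultimately show ?thesis
      using bct_side_area[OF _ st _ dim] by blast
  qed
  have top: "planar_area (F (0, 0, k)) = (s\<^sup>2 - t\<^sup>2)\<^sup>2 / s\<^sup>2" if "k \<in> {2, -2}" "t < s" for k
  proof -
    \<comment> \<open>The vertical relevant vectors have third coordinate 2 or -2, so the sign of
      the axis is \<open>k / 2\<close>.\<close>
    have k: "(k / 2 :: real) = 1 \<or> (k / 2 :: real) = -1"
      using that by auto
    then have "orthonormal3 a b ((k / 2) *\<^sub>R c)"
      using o by (auto simp: orthonormal3_def)
    moreover have "F (0, 0, k) = bct_cell s t a b ((k / 2) *\<^sub>R c) \<inter>
        {x. (2 * t) *\<^sub>R (k / 2) *\<^sub>R c \<bullet> x = (2 * t) *\<^sub>R (k / 2) *\<^sub>R c \<bullet> (2 * t) *\<^sub>R (k / 2) *\<^sub>R c / 2}"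
      using that by (auto simp: F_def bct_vec_def bct_cell_def)
    moreover have "(0, 0, k) \<in> ?I"
      using that by (auto simp: bct_relevant_def)
    ultimately show ?thesis
      using bct_top_area[OF _ st(1) that(2) _ dim] by blast
  qed
  have "surface_area ?P = (\<Sum>i\<in>?I. planar_area (F i))"
    unfolding surface_area_def using sum.reindex_bij_betw[OF facets(1)] by metis
  also have "\<dots> = 8 * (sqrt (s\<^sup>2 + t\<^sup>2) * (t - t^3 / (2 * s\<^sup>2))) + 4 * (t^3 / (sqrt 2 * s)) + 2 * ((s\<^sup>2 - t\<^sup>2)\<^sup>2 / s\<^sup>2)"
  proof (cases "t < s")
    case True
    then show ?thesis
      by (simp add: bct_relevant_def slant side top)
  next
    case False
    then have "s = t" using st by simp
    then show ?thesis
      using slant side by (simp add: bct_relevant_def)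
  qed
  finally show ?thesis .
qed

section \<open>The isoperimetric profile\<close>

text \<open>\<open>16 powr (1 / 3)\<close> times the isoperimetric quotient, for \<open>m = sqrt ((p + q) / (2 * q))\<close>.\<close>
definition bct_profile :: "real \<Rightarrow> real" where
  "bct_profile m =
     ((2 * m\<^sup>2 - 1)\<^sup>2 + 2 * m + 2 * sqrt (2 * m\<^sup>2 + 1) * (4 * m\<^sup>2 - 1)) * m powr (- 10 / 3)"

text \<open>Equality holds at \<open>m = 1 / sqrt 2\<close>, the face-centred cubic lattice, so after squaring the
  difference of the two sides is divisible by \<open>2 * m\<^sup>2 - 1\<close>; all coefficients of the quotient are positive.\<close>
lemma bct_profile_factor_pos:
  fixes m :: real
  assumes "0 < m" "1 < 2 * m\<^sup>2"
  shows "4 * (m + 1) * (4 * m\<^sup>2 + 5) / sqrt (2 * m\<^sup>2 + 1) < 8 * m^3 + 8 * m\<^sup>2 + 24 * m + 10"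
proof -
  define R where "R = sqrt (2 * m\<^sup>2 + 1)"
  have R: "0 < R" "R\<^sup>2 = 2 * m\<^sup>2 + 1"
    by (simp_all add: R_def add_nonneg_pos)
  let ?U = "4 * m^3 + 4 * m\<^sup>2 + 12 * m + 5" and ?V = "2 * (m + 1) * (4 * m\<^sup>2 + 5)"
  have "?U\<^sup>2 * (2 * m\<^sup>2 + 1) - ?V\<^sup>2
      = (2 * m\<^sup>2 - 1) * (16 * m^6 + 32 * m^5 + 96 * m^4 + 104 * m^3 + 176 * m\<^sup>2 + 80 * m + 75)"
    by algebra
  also have "\<dots> > 0"
    using assms by (intro mult_pos_pos add_nonneg_pos) auto
  finally have "?V\<^sup>2 < (?U * R)\<^sup>2"
    using R by (simp add: power_mult_distrib)
  moreover have "0 \<le> ?U * R"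
    using assms R by simp
  ultimately have "?V < ?U * R"
    using power2_less_imp_less by blast
  then have "2 * ?V / R < 2 * ?U"
    unfolding pos_divide_less_eq[OF R(1)] by linarith
  then show ?thesis
    by (simp add: R_def algebra_simps)
qed

text \<open>The factor \<open>m - 1\<close> exhibits the critical point; the remaining bracket is
  the one shown positive in \<open>bct_profile_factor_pos\<close>.\<close>

lemma bct_profile_deriv:
  fixes m :: real
  assumes "0 < m"
  shows "(bct_profile has_real_derivative m powr (- 13 / 3) / 3 * ((m - 1) *
      (8 * m^3 + 8 * m\<^sup>2 + 24 * m + 10 - 4 * (m + 1) * (4 * m\<^sup>2 + 5) / sqrt (2 * m\<^sup>2 + 1)))) (at m)"
proof -
  define R where "R = sqrt (2 * m\<^sup>2 + 1)"
  have R: "0 < R" "R\<^sup>2 = 2 * m\<^sup>2 + 1"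
    by (simp_all add: R_def add_nonneg_pos)
  define N where "N = (2 * m\<^sup>2 - 1)\<^sup>2 + 2 * m + 2 * R * (4 * m\<^sup>2 - 1)"
  define N' where "N' = 8 * m * (2 * m\<^sup>2 - 1) + 2 + 4 * m * (4 * m\<^sup>2 - 1) / R + 16 * m * R"
  have pw: "m powr (- 10 / 3) = m * m powr (- 13 / 3)"
    using assms powr_add[of m 1 "- 13 / 3"] by simp
  have sq: "((\<lambda>m. sqrt (2 * m\<^sup>2 + 1)) has_real_derivative 2 * m / R) (at m)"
    using R by (auto intro!: derivative_eq_intros simp: R_def field_simps)
  have "((\<lambda>m. (2 * m\<^sup>2 - 1)\<^sup>2 + 2 * m + 2 * sqrt (2 * m\<^sup>2 + 1) * (4 * m\<^sup>2 - 1)) has_real_derivative N') (at m)"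
  proof -
    define f where "f = (\<lambda>m::real. sqrt (2 * m\<^sup>2 + 1))"
    have f: "(f has_real_derivative 2 * m / R) (at m)" "f m = R"
      using sq by (simp_all add: f_def R_def)
    have "((\<lambda>m. (2 * m\<^sup>2 - 1)\<^sup>2 + 2 * m + 2 * f m * (4 * m\<^sup>2 - 1)) has_real_derivative N') (at m)"
      by (rule derivative_eq_intros f(1) refl)+ (simp add: N'_def f(2) algebra_simps diff_divide_distrib)
    then show ?thesis by (simp add: f_def)
  qed
  moreover have "((\<lambda>m. m powr (- 10 / 3)) has_real_derivative (- 10 / 3) * m powr (- 13 / 3)) (at m)"
    using has_real_derivative_powr[OF assms, of "- 10 / 3"] by simp
  ultimately have "(bct_profile has_real_derivative N' * m powr (- 10 / 3) + (- 10 / 3) * m powr (- 13 / 3) * N) (at m)"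
    unfolding bct_profile_def[abs_def] N_def R_def by (rule DERIV_mult)
  also have "N' * m powr (- 10 / 3) + (- 10 / 3) * m powr (- 13 / 3) * N
      = m powr (- 13 / 3) / 3 * (3 * m * N' - 10 * N)"
    unfolding pw by (simp add: algebra_simps)
  also have "3 * m * N' - 10 * N = (m - 1) * (8 * m^3 + 8 * m\<^sup>2 + 24 * m + 10 - 4 * (m + 1) * (4 * m\<^sup>2 + 5) / R)"
  proof -
    \<comment> \<open>Multiplying by \<open>R\<close> clears the denominator, and substituting for
      \<open>R\<^sup>2\<close> leaves an identity linear in \<open>R\<close> with polynomial
      coefficients.\<close>
    have "(3 * m * N' - 10 * N) * R =
      (3 * m * (8 * m * (2 * m\<^sup>2 - 1) + 2) - 10 * ((2 * m\<^sup>2 - 1)\<^sup>2 + 2 * m)) * R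
      + 3 * m * (4 * m * (4 * m\<^sup>2 - 1) + 16 * m * R\<^sup>2) - 20 * R\<^sup>2 * (4 * m\<^sup>2 - 1)"
      using R(1) by (simp add: N_def N'_def field_simps power2_eq_square)
    also have "\<dots> = (m - 1) * ((8 * m^3 + 8 * m\<^sup>2 + 24 * m + 10) * R - 4 * (m + 1) * (4 * m\<^sup>2 + 5))"
      unfolding R(2) by algebra
    also have "\<dots> = (m - 1) * (8 * m^3 + 8 * m\<^sup>2 + 24 * m + 10 - 4 * (m + 1) * (4 * m\<^sup>2 + 5) / R) * R"
      using R(1) by (simp add: field_simps)
    finally show ?thesis
      using R(1) by simp
  qed
  finally show ?thesis
    by (simp add: R_def)
qed

text \<open>The profile decreases strictly up to 1 and increases strictly after it.\<close>

lemma bct_profile_min: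
  fixes m :: real
  assumes "0 < m" "1 \<le> 2 * m\<^sup>2" "m \<noteq> 1"
  shows "bct_profile 1 < bct_profile m"
proof -
  have cont: "continuous_on {a..b} bct_profile" if "0 < a" for a b
    using that by (intro continuous_at_imp_continuous_on ballI)
      (auto intro!: DERIV_isCont[OF bct_profile_deriv])
  show ?thesis
  proof (cases "m < 1")
    case True
    \<comment> \<open>The derivative is needed only strictly inside the interval, which admits the
      endpoint \<open>m = 1 / sqrt 2\<close>, where the bracket vanishes.\<close>
    have "\<exists>y. (bct_profile has_real_derivative y) (at x) \<and> y < 0" if x: "m < x" "x < 1" for x
    proof (intro exI conjI)
      have "m\<^sup>2 < x\<^sup>2"
        using x assms by (intro power_strict_mono) auto
      then show "x powr (- 13 / 3) / 3 * ((x - 1) *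
          (8 * x^3 + 8 * x\<^sup>2 + 24 * x + 10 - 4 * (x + 1) * (4 * x\<^sup>2 + 5) / sqrt (2 * x\<^sup>2 + 1))) < 0"
        using bct_profile_factor_pos[of x] x assms by (intro mult_pos_neg mult_neg_pos) auto
    qed (use bct_profile_deriv x assms in auto)
    then show ?thesis
      using DERIV_neg_imp_decreasing_open[OF True _ cont] assms by blast
  next
    case False
    then have "1 < m" using assms by simp
    moreover have "\<exists>y. (bct_profile has_real_derivative y) (at x) \<and> 0 < y" if x: "1 < x" for x
    proof (intro exI conjI)
      have "1 < 2 * x\<^sup>2"
        using x less_1_mult[of x x] by (simp add: power2_eq_square)
      then show "0 < x powr (- 13 / 3) / 3 * ((x - 1) *
          (8 * x^3 + 8 * x\<^sup>2 + 24 * x + 10 - 4 * (x + 1) * (4 * x\<^sup>2 + 5) / sqrt (2 * x\<^sup>2 + 1)))"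
        using bct_profile_factor_pos[of x] x by (intro mult_pos_pos) (auto simp: diff_gt_0_iff_gt)
    qed (use bct_profile_deriv x in auto)
    ultimately show ?thesis
      using DERIV_pos_imp_increasing_open[OF _ _ cont] by simp
  qed
qed

section \<open>The lattice\<close>

text \<open>The triple \<open>(i, j, k)\<close> is a sum of copies of \<open>(1,1,0)\<close>,
  \<open>(1,0,1)\<close> and either \<open>(0,0,2)\<close> or \<open>(2,0,0)\<close>. The bounds for
  these summands add up, and the total is dominated by the squares because
  \<open>n \<le> n * n\<close> for naturals.\<close>

lemma bct_lattice_bound_ordered:
  fixes S T U V W :: real and i j k :: nat
  assumes "0 \<le> U" "0 \<le> V" "0 \<le> W" "U + V \<le> S" "W \<le> T" "U + W \<le> (S + T) / 2"
    and "j \<le> i" "even (i + j + k)"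
  shows "2 * (i * U + j * V + k * W) \<le> S * (i * i + j * j) + T * (k * k)"
proof -
  have S: "0 \<le> S" and T: "0 \<le> T"
    using assms by linarith+
  obtain m where m: "i = j + m"
    using assms le_Suc_ex by blast
  have sq: "n \<le> n * n" for n :: nat
    by (cases n) auto
  have jS: "j * (U + V) \<le> j * S"
    using assms by (intro mult_left_mono) auto
  have "even m \<longleftrightarrow> even k"
    using assms m by auto
  \<comment> \<open>By parity, what remains after the copies of \<open>(1,1,0)\<close> and
    \<open>(1,0,1)\<close> is an even multiple of one axis.\<close>
  then consider r where "k = m + 2 * r" | r where "m = k + 2 * r"
  proof (cases "m \<le> k")
    case True
    with \<open>even m \<longleftrightarrow> even k\<close> have "even (k - m)" by simp
    then obtain r where "k - m = 2 * r" by blast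
    with True that(1)[of r] show ?thesis by linarith
  next
    case False
    with \<open>even m \<longleftrightarrow> even k\<close> have "even (m - k)" by simp
    then obtain r where "m - k = 2 * r" by blast
    with False that(2)[of r] show ?thesis by linarith
  qed
  then show ?thesis
  proof cases
    case 1
    have "m * (U + W) \<le> m * ((S + T) / 2)" "r * W \<le> r * T"
      by (rule mult_left_mono; use assms in simp)+
    moreover have "2 * j + m \<le> i * i + j * j" "m + 4 * r \<le> k * k"
      unfolding m 1 distrib_left distrib_right using sq[of j] sq[of m] sq[of r] by linarith+
    then have "S * (2 * j + m) \<le> S * (i * i + j * j)" "T * (m + 4 * r) \<le> T * (k * k)"
      using S T by (simp_all only: of_nat_le_iff mult_left_mono)
    moreover have "2 * (i * U + j * V + k * W) = 2 * (j * (U + V)) + 2 * (m * (U + W)) + 4 * (r * W)"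
      by (simp add: m 1 algebra_simps)
    ultimately show ?thesis
      using jS by (simp add: algebra_simps)
  next
    case 2
    have "k * (U + W) \<le> k * ((S + T) / 2)" "r * U \<le> r * S"
      by (rule mult_left_mono; use assms in simp)+
    moreover have "2 * j + k + 4 * r \<le> i * i + j * j" "k \<le> k * k"
      unfolding m 2 distrib_left distrib_right using sq[of j] sq[of k] sq[of r] by linarith+
    then have "S * (2 * j + k + 4 * r) \<le> S * (i * i + j * j)" "T * k \<le> T * (k * k)"
      using S T by (simp_all only: of_nat_le_iff mult_left_mono)
    moreover have "2 * (i * U + j * V + k * W) = 2 * (j * (U + V)) + 2 * (k * (U + W)) + 4 * (r * U)"
      by (simp add: m 2 algebra_simps)
    ultimately show ?thesis
      using jS by (simp add: algebra_simps)
  qed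
qed

lemma bct_lattice_bound:
  fixes S T U V W :: real and i j k :: nat
  assumes "0 \<le> U" "0 \<le> V" "0 \<le> W" "U + V \<le> S" "W \<le> T" "U + W \<le> (S + T) / 2" "V + W \<le> (S + T) / 2"
    and "even (i + j + k)"
  shows "2 * (i * U + j * V + k * W) \<le> S * (i * i + j * j) + T * (k * k)"
proof (cases "j \<le> i")
  case True
  then show ?thesis
    using bct_lattice_bound_ordered assms by blast
next
  case False
  then show ?thesis
    using bct_lattice_bound_ordered[of V U W S T i j k] assms by (simp add: ac_simps)
qed

text \<open>The substantial inclusion says that the finitely many relevant halfspaces imply those of
  all lattice vectors; this is \<open>bct_lattice_bound\<close> applied to absolute values of
  coordinates.\<close>

lemma voronoi_cell_bct:
  assumes o: "orthonormal3 a b c" and st: "0 < t" "t \<le> s"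
    and L: "L = {bct_vec s t a b c (i, j, k) | i j k. even (i + j + k)}"
  shows "voronoi_cell L = bct_cell s t a b c"
proof -
  let ?w = "bct_vec s t a b c"
  have closer: "dist x 0 \<le> dist x y \<longleftrightarrow> y \<bullet> x \<le> y \<bullet> y / 2" for x y :: "real^3"
    by (simp add: dist_norm norm_le inner_diff_left inner_diff_right inner_commute field_simps)
  show ?thesis
  proof (intro subset_antisym subsetI)
    fix x assume x: "x \<in> voronoi_cell L"
    have "?w i \<bullet> x \<le> ?w i \<bullet> ?w i / 2" if "i \<in> bct_relevant s t" for i
    proof -
      have "?w i \<in> L"
      proof -
        have "\<forall>(i, j, k)\<in>bct_relevant s t. even (i + j + k)"
          by (simp add: bct_relevant_def)
        then show ?thesis
          using that unfolding L by (cases i) blast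
      qed
      then show ?thesis
        using x unfolding voronoi_cell_def closer by blast
    qed
    then show "x \<in> bct_cell s t a b c"
      using bct_cell_relevant[OF o st] by blast
  next
    fix x assume x: "x \<in> bct_cell s t a b c"
    have "?w (i, j, k) \<bullet> x \<le> ?w (i, j, k) \<bullet> ?w (i, j, k) / 2" if ev: "even (i + j + k)" for i j k
    proof -
      let ?U = "s * \<bar>x \<bullet> a\<bar>" and ?V = "s * \<bar>x \<bullet> b\<bar>" and ?W = "t * \<bar>x \<bullet> c\<bar>"
      have "s * (\<bar>x \<bullet> a\<bar> + \<bar>x \<bullet> b\<bar>) \<le> s * s" "t * \<bar>x \<bullet> c\<bar> \<le> t * t"
        using x st by (auto simp: bct_cell_def)
      moreover have "even (nat \<bar>i\<bar> + nat \<bar>j\<bar> + nat \<bar>k\<bar>)"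
        using ev by (simp add: even_nat_iff)
      ultimately have bound: "2 * (nat \<bar>i\<bar> * ?U + nat \<bar>j\<bar> * ?V + nat \<bar>k\<bar> * ?W)
          \<le> s\<^sup>2 * (nat \<bar>i\<bar> * nat \<bar>i\<bar> + nat \<bar>j\<bar> * nat \<bar>j\<bar>) + t\<^sup>2 * (nat \<bar>k\<bar> * nat \<bar>k\<bar>)"
        using x st by (intro bct_lattice_bound) (auto simp: bct_cell_def power2_eq_square distrib_left)
      have "s * i * (x \<bullet> a) \<le> nat \<bar>i\<bar> * ?U" "s * j * (x \<bullet> b) \<le> nat \<bar>j\<bar> * ?V" "t * k * (x \<bullet> c) \<le> nat \<bar>k\<bar> * ?W"
        using st abs_ge_self[of "s * i * (x \<bullet> a)"] abs_ge_self[of "s * j * (x \<bullet> b)"] abs_ge_self[of "t * k * (x \<bullet> c)"]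
        by (simp_all add: abs_mult mult_ac)
      with bound show ?thesis
        unfolding bct_vec_inner(1)[OF o] bct_vec_inner(2)[OF o, of s t _ _ _ x]
        by simp
    qed
    then show "x \<in> voronoi_cell L"
      unfolding voronoi_cell_def closer L by blast
  qed
qed

lemma lattice_span_bct:
  fixes v :: "3 \<Rightarrow> real^3"
  assumes "v 1 = bct_vec s t a b c (-1, 0, 1)" "v 2 = bct_vec s t a b c (0, 1, -1)" "v 3 = bct_vec s t a b c (0, -1, -1)"
  shows "lattice_span v = {bct_vec s t a b c (i, j, k) | i j k. even (i + j + k)}"
proof -
  have comb: "(\<Sum>i\<in>UNIV. of_int (f i) *\<^sub>R v i) = bct_vec s t a b c (- f 1, f 2 - f 3, f 1 - f 2 - f 3)" for f :: "3 \<Rightarrow> int"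
    by (simp add: sum_3 assms bct_vec_def algebra_simps)
  show ?thesis
  proof (intro set_eqI iffI)
    fix x assume "x \<in> lattice_span v"
    then obtain f where "x = (\<Sum>i\<in>UNIV. of_int (f i) *\<^sub>R v i)"
      by (auto simp: lattice_span_def)
    then have "x = bct_vec s t a b c (- f 1, f 2 - f 3, f 1 - f 2 - f 3)"
      using comb by simp
    moreover have "even (- f 1 + (f 2 - f 3) + (f 1 - f 2 - f 3))"
      by simp
    ultimately show "x \<in> {bct_vec s t a b c (i, j, k) | i j k. even (i + j + k)}"
      by blast
  next
    fix x assume "x \<in> {bct_vec s t a b c (i, j, k) | i j k. even (i + j + k)}"
    then obtain i j k where x: "x = bct_vec s t a b c (i, j, k)" and "even (i + j + k)"
      by blast
    then obtain l where l: "i + j + k = 2 * l"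
      by blast
    \<comment> \<open>Solution of \<open>- f 1 = i\<close>, \<open>f 2 - f 3 = j\<close>,
      \<open>f 1 - f 2 - f 3 = k\<close>; evenness of \<open>i + j + k\<close> makes it
      integral.\<close>
    define f where "f = (\<lambda>n::3. if n = 1 then - i else if n = 2 then j - l else - l)"
    have "f 1 = - i" "f 2 = j - l" "f 3 = - l"
      by (simp_all add: f_def)
    then have "x = (\<Sum>i\<in>UNIV. of_int (f i) *\<^sub>R v i)"
      using l by (simp add: comb x) (metis add.commute add_diff_cancel_left' diff_diff_eq2 minus_diff_eq mult_2 uminus_add_conv_diff)
    then show "x \<in> lattice_span v"
      by (auto simp: lattice_span_def)
  qed
qed

section \<open>From the Gram matrix to a closed form of the quotient\<close>

lemma det_selling_matrix_bct: "det (selling_matrix p q q q q p) = 4 * (p + q)\<^sup>2 * q"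
  by (simp add: selling_matrix_def det_3 power2_eq_square algebra_simps)

text \<open>The basis in the quotient is an arbitrary choice, so every basis with this Gram matrix
  must be brought to standard form. The frame is found by solving the three equations for
  \<open>a\<close>, \<open>b\<close>, \<open>c\<close>; its orthonormality depends only on the Gram
  matrix.\<close>

lemma gram_matrix_bct_frame:
  fixes v :: "3 \<Rightarrow> real^3"
  assumes st: "0 < s" "0 < t" and g: "gram_matrix v = selling_matrix (s\<^sup>2 - t\<^sup>2) (t\<^sup>2) (t\<^sup>2) (t\<^sup>2) (t\<^sup>2) (s\<^sup>2 - t\<^sup>2)"
  obtains a b c where "orthonormal3 a b c"
    "v 1 = bct_vec s t a b c (-1, 0, 1)" "v 2 = bct_vec s t a b c (0, 1, -1)" "v 3 = bct_vec s t a b c (0, -1, -1)"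
proof
  have "v i \<bullet> v j = selling_matrix (s\<^sup>2 - t\<^sup>2) (t\<^sup>2) (t\<^sup>2) (t\<^sup>2) (t\<^sup>2) (s\<^sup>2 - t\<^sup>2) $ i $ j" for i j
    unfolding g[symmetric] by (simp add: gram_matrix_def)
  then have in1: "v 1 \<bullet> v 1 = s\<^sup>2 + t\<^sup>2" "v 2 \<bullet> v 2 = s\<^sup>2 + t\<^sup>2" "v 3 \<bullet> v 3 = s\<^sup>2 + t\<^sup>2"
     "v 1 \<bullet> v 2 = - t\<^sup>2" "v 1 \<bullet> v 3 = - t\<^sup>2" "v 2 \<bullet> v 3 = t\<^sup>2 - s\<^sup>2"
    by (simp_all add: selling_matrix_def)
  then have in2: "v 2 \<bullet> v 1 = - t\<^sup>2" "v 3 \<bullet> v 1 = - t\<^sup>2" "v 3 \<bullet> v 2 = t\<^sup>2 - s\<^sup>2"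
    by (simp_all add: inner_commute)
  define a where "a = (- 1 / (2 * s)) *\<^sub>R (2 *\<^sub>R v 1 + v 2 + v 3)"
  define b where "b = (1 / (2 * s)) *\<^sub>R (v 2 - v 3)"
  define c where "c = (- 1 / (2 * t)) *\<^sub>R (v 2 + v 3)"
  show "orthonormal3 a b c"
    unfolding orthonormal3_def using st
    by (simp add: a_def b_def c_def inner_left_distrib inner_right_distrib inner_diff_left inner_diff_right in1 in2)
      (simp add: field_simps power2_eq_square)
  show "v 1 = bct_vec s t a b c (-1, 0, 1)" "v 2 = bct_vec s t a b c (0, 1, -1)" "v 3 = bct_vec s t a b c (0, -1, -1)"
    using st by (simp_all add: bct_vec_def a_def b_def c_def algebra_simps flip: scaleR_add_left)
qed

lemma gram_matrix_bct_exists: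
  "\<exists>v :: 3 \<Rightarrow> real^3. gram_matrix v = selling_matrix (s\<^sup>2 - t\<^sup>2) (t\<^sup>2) (t\<^sup>2) (t\<^sup>2) (t\<^sup>2) (s\<^sup>2 - t\<^sup>2)"
proof -
  define v :: "3 \<Rightarrow> real^3" where
    "v = (\<lambda>n. if n = 1 then vector [-s, 0, t] else if n = 2 then vector [0, s, -t] else vector [0, -s, -t])"
  have "gram_matrix v = selling_matrix (s\<^sup>2 - t\<^sup>2) (t\<^sup>2) (t\<^sup>2) (t\<^sup>2) (t\<^sup>2) (s\<^sup>2 - t\<^sup>2)"
    by (simp add: vec_eq_iff forall_3 gram_matrix_def selling_matrix_def v_def inner_vec_def sum_3 power2_eq_square)
  then show ?thesis by blast
qed

text \<open>With \<open>s = sqrt 2 * t * m\<close>, the area and the cube root of the determinant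
  both carry the factor \<open>t\<^sup>2\<close>, which cancels and leaves a function of
  \<open>m\<close> alone.\<close>

lemma isoperimetric_quotient_bct:
  fixes p q :: real
  assumes "0 \<le> p" "0 < q"
  shows "isoperimetric_quotient p q q q q p = bct_profile (sqrt ((p + q) / (2 * q))) / 16 powr (1 / 3)"
proof -
  define s t where "s = sqrt (p + q)" and "t = sqrt q"
  have st: "0 < t" "t \<le> s" "s\<^sup>2 = p + q" "t\<^sup>2 = q"
    using assms by (simp_all add: s_def t_def)
  have pq: "selling_matrix p q q q q p = selling_matrix (s\<^sup>2 - t\<^sup>2) (t\<^sup>2) (t\<^sup>2) (t\<^sup>2) (t\<^sup>2) (s\<^sup>2 - t\<^sup>2)"
    by (simp add: st)
  define v :: "3 \<Rightarrow> real^3" where "v = (SOME v. gram_matrix v = selling_matrix p q q q q p)"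
  have "gram_matrix v = selling_matrix p q q q q p"
    unfolding v_def pq by (rule someI_ex[OF gram_matrix_bct_exists])
  then obtain a b c where o: "orthonormal3 a b c" and
    v: "v 1 = bct_vec s t a b c (-1, 0, 1)" "v 2 = bct_vec s t a b c (0, 1, -1)" "v 3 = bct_vec s t a b c (0, -1, -1)"
    using gram_matrix_bct_frame[of s t v] st unfolding pq by auto
  have cell: "voronoi_cell (lattice_span v) = bct_cell s t a b c"
    using voronoi_cell_bct[OF o st(1,2) lattice_span_bct[OF v]] .
  define m where "m = sqrt ((p + q) / (2 * q))"
  have m: "0 < m" using assms by (simp add: m_def)
  have m2: "m\<^sup>2 = (p + q) / (2 * q)"
    using assms by (simp add: m_def)
  have s: "s = sqrt 2 * t * m"
    using assms by (simp add: s_def t_def m_def flip: real_sqrt_mult)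
  have s2: "s\<^sup>2 = 2 * t\<^sup>2 * m\<^sup>2"
    using assms by (simp add: st m2)
  define R where "R = sqrt (2 * m\<^sup>2 + 1)"
  have r: "sqrt (s\<^sup>2 + t\<^sup>2) = t * R"
  proof -
    have "s\<^sup>2 + t\<^sup>2 = t\<^sup>2 * (2 * m\<^sup>2 + 1)"
      by (simp add: s2 algebra_simps)
    then show ?thesis
      using st(1) by (simp add: R_def real_sqrt_mult)
  qed
  \<comment> \<open>The first factor of \<open>bct_profile m\<close>; the area supplies
    \<open>m powr (- 2)\<close> and the determinant \<open>m powr (- 4 / 3)\<close>.\<close>
  define N where "N = (2 * m\<^sup>2 - 1)\<^sup>2 + 2 * m + 2 * R * (4 * m\<^sup>2 - 1)"
  have area: "surface_area (bct_cell s t a b c) = t\<^sup>2 * (N / m\<^sup>2)"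
  proof -
    have "8 * (sqrt (s\<^sup>2 + t\<^sup>2) * (t - t^3 / (2 * s\<^sup>2))) = t\<^sup>2 * (2 * R * (4 * m\<^sup>2 - 1) / m\<^sup>2)"
      unfolding r unfolding s2 using st(1) m by (simp add: field_simps power2_eq_square power3_eq_cube)
    moreover have "4 * (t^3 / (sqrt 2 * s)) = t\<^sup>2 * (2 * m / m\<^sup>2)"
    proof -
      have "sqrt 2 * s = 2 * t * m" unfolding s by simp
      then show ?thesis
        using st(1) m by (simp add: field_simps power2_eq_square power3_eq_cube)
    qed
    moreover have "2 * ((s\<^sup>2 - t\<^sup>2)\<^sup>2 / s\<^sup>2) = t\<^sup>2 * ((2 * m\<^sup>2 - 1)\<^sup>2 / m\<^sup>2)"
    proof -
      have "s\<^sup>2 - t\<^sup>2 = t\<^sup>2 * (2 * m\<^sup>2 - 1)" by (simp add: s2 algebra_simps)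
      then show ?thesis
        unfolding s2 using st(1) m by (simp add: power_mult_distrib) (simp add: field_simps power2_eq_square power4_eq_xxxx)
    qed
    ultimately show ?thesis
      unfolding bct_surface_area[OF o st(1,2)] N_def by (simp add: distrib_left add_divide_distrib)
  qed
  have vol: "det (selling_matrix p q q q q p) powr (1 / 3) = 16 powr (1 / 3) * (t\<^sup>2 * m powr (4 / 3))"
  proof -
    have "det (selling_matrix p q q q q p) = 16 * ((t\<^sup>2)^3 * m^4)"
    proof -
      have "p + q = 2 * t\<^sup>2 * m\<^sup>2" using s2 st by simp
      then show ?thesis
        unfolding det_selling_matrix_bct using st(4) by (simp add: power_mult_distrib power2_eq_square power3_eq_cube power4_eq_xxxx)
    qed
    moreover have "((t\<^sup>2)^3) powr (1 / 3) = t\<^sup>2"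
      using st(1) by (simp add: powr_powr flip: powr_numeral)
    moreover have "(m^4) powr (1 / 3) = m powr (4 / 3)"
      using m by (simp add: powr_powr flip: powr_numeral)
    ultimately show ?thesis
      using st m by (simp add: powr_mult)
  qed
  have profile: "bct_profile m = N / m\<^sup>2 / m powr (4 / 3)"
  proof -
    have "m powr (- 10 / 3) = m powr (- 2) * m powr (- (4 / 3))"
      by (simp flip: powr_add)
    also have "\<dots> = 1 / m\<^sup>2 / m powr (4 / 3)"
      using m by (simp add: powr_minus field_simps)
    finally show ?thesis
      by (simp add: bct_profile_def N_def R_def)
  qed
  have quotient: "isoperimetric_quotient p q q q q p =
      surface_area (bct_cell s t a b c) / det (selling_matrix p q q q q p) powr (1 / 3)"
    by (simp only: isoperimetric_quotient_def Let_def v_def[symmetric] cell)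
  show ?thesis
    unfolding m_def[symmetric] quotient area vol profile using st(1) by simp
qed

theorem theorem4p2:
  fixes p q :: real
  assumes "p \<ge> 0" and "q \<ge> 0"
  shows "(det (selling_matrix p q q q q p) > 0 \<longleftrightarrow> q > 0) \<and>
         (det (selling_matrix p q q q q p) > 0 \<longrightarrow>
            isoperimetric_quotient p q q q q p \<ge> isoperimetric_quotient 1 1 1 1 1 1 \<and>
            (isoperimetric_quotient p q q q q p = isoperimetric_quotient 1 1 1 1 1 1 \<longleftrightarrow> p = q))"
proof -
  have det: "det (selling_matrix p q q q q p) > 0 \<longleftrightarrow> q > 0"
    unfolding det_selling_matrix_bct using assms by (cases "q = 0") auto
  moreover have "isoperimetric_quotient p q q q q p \<ge> isoperimetric_quotient 1 1 1 1 1 1 \<and>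
      (isoperimetric_quotient p q q q q p = isoperimetric_quotient 1 1 1 1 1 1 \<longleftrightarrow> p = q)" if q: "q > 0"
  proof -
    \<comment> \<open>Here \<open>2 * m\<^sup>2 = (p + q) / q\<close>, so \<open>p \<ge> 0\<close>
      places \<open>m\<close> in the range of \<open>bct_profile_min\<close>, and
      \<open>p = q\<close> is its minimum point.\<close>
    define m where "m = sqrt ((p + q) / (2 * q))"
    have m: "0 < m" "1 \<le> 2 * m\<^sup>2" "m = 1 \<longleftrightarrow> p = q"
      using assms q by (auto simp: m_def field_simps)
    have "isoperimetric_quotient p q q q q p = bct_profile m / 16 powr (1 / 3)"
      using isoperimetric_quotient_bct assms q by (simp add: m_def)
    moreover have "isoperimetric_quotient 1 1 1 1 1 1 = bct_profile 1 / 16 powr (1 / 3)"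
      using isoperimetric_quotient_bct[of 1 1] by simp
    moreover have "m \<noteq> 1 \<Longrightarrow> bct_profile 1 < bct_profile m"
      using bct_profile_min m by blast
    ultimately show ?thesis
      using m(3) by (cases "m = 1") (auto simp: divide_strict_right_mono less_imp_le dest: less_imp_neq)
  qed
  ultimately show ?thesis by blast
qed

end
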